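(* Let $\Omega\subset\mathbb R^2$ be the meshed domain of the context. For all $(s^h,\hat s^h)\in\widetilde S(\Omega)\times\widetilde D(\partial\Omega)$, $$\widetilde{\mathrm{ROT}}\big(\widetilde{\mathrm{GRAD}}(s^h,\hat s^h)\big)=(0,0).$$ Hence the range of $\widetilde{\mathrm{GRAD}}$ on $\widetilde S(\Omega)\times\widetilde D(\partial\Omega)$ is contained in the null space of $\widetilde{\mathrm{ROT}}$ on $\widetilde D(\Omega)\times\widetilde C(\partial\Omega)$.
   Context: Fix $N\ge1$; let $-1=\xi_0<\dots<\xi_N=1$ be the Gauss–Lobatto–Legendre (GLL) nodes, i.e. the roots of $(1-\xi^2)L_N'(\xi)$, $L_N$ the Legendre polynomial of degree $N$. $\mathcal P$, $\mathcal Q$ are the polynomials on $[-1,1]$ of degree at most $N$, $N-1$. On $K=[-1,1]^2$: $C(K)=\mathcal P\otimes\mathcal P$, $D(K)=(\mathcal P\otimes\mathcal Q)\times(\mathcal Q\otimes\mathcal P)$, $S(K)=\mathcal Q\otimes\mathcal Q$. $\Omega\subset\mathbb R^2$ is a bounded Lipschitz domain with outward unit normal $\boldsymbol n$, partitioned into conforming non-overlapping elements $\Omega_m=\Phi_m(K)$, with $\Phi_m$ diffeomorphisms with Jacobian matrix $\mathsf J$ ($\det\mathsf J>0$), such that the global map is continuous; the images of the GLL grid form a global mesh of nodes, small edges and small cells. $C(\Omega)$: continuous functions equal to $\bar f\circ\Phi_m^{-1}$, $\bar f\in C(K)$, on each $\Omega_m$. $D(\Omega)$: vector fields with continuous normal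 component across element boundaries, equal to $\big(\frac1{\det\mathsf J}\mathsf J\bar{\boldsymbol u}\big)\circ\Phi_m^{-1}$, $\bar{\boldsymbol u}\in D(K)$, on each $\Omega_m$. $S(\Omega)$: functions equal to $\big(\frac1{\det\mathsf J}\bar g\big)\circ\Phi_m^{-1}$, $\bar g\in S(K)$, on each $\Omega_m$. Degrees of freedom (column vectors): $\mathcal N^0$ = values at the nodes for $C(\Omega)$; $\mathcal N^1$ = fluxes through the small edges (each with a fixed chosen unit normal) for $D(\Omega)$; $\mathcal N^2$ = integrals over the small cells for $S(\Omega)$. $\Psi^0,\Psi^1,\Psi^2$ are the corresponding row vectors of basis functions, so each function equals $\Psi^k\mathcal N^k(\cdot)$. With $\mathrm{curl}\,\omega=(\partial_y\omega,-\partial_x\omega)^\intercal$, the incidence matrices (entries $-1,0,1$) are defined by $\mathrm{curl}\,\omega^h=\Psi^1\mathbb E^{1,0}\mathcal N^0(\omega^h)$ on $C(\Omega)$ and $\mathrm{div}\,\boldsymbol q^h=\Psi^2\mathbb E^{2,1}\mathcal N^1(\boldsymbol q^h)$ on $D(\Omega)$. Mass matrices $\mathbb M^{(k)}=\int_\Omega(\Psi^k)^\intercal\Psi^k\,\mathrm d\Omega$; dual bases $\widetilde\Psi^{2-k}=\Psi^k(\mathbb M^{(k)})^{-1}$; dual degrees of freedom $\widetilde{\mathcal N}^{2-k}=\mathbb M^{(k)}\mathcal N^k$. $\widetilde C(\Omega)$, $\widetilde D(\Omega)$, $\widetilde S(\Omega)$ are the spaces $C(\Omega)$, $D(\Omega)$,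 $S(\Omega)$ with elements expanded in the dual bases $\widetilde\Psi^2,\widetilde\Psi^1,\widetilde\Psi^0$. Inclusion matrices: $\mathbb N_1$ (rows: small edges; columns: small edges in $\partial\Omega$) has in the column of a boundary edge a single non-zero entry, in the row of that edge, equal to $+1$ if its chosen normal is outward and $-1$ otherwise. $\mathbb N_0$ (rows: nodes; columns: nodes on $\partial\Omega$) has in the column of a boundary node the single non-zero entry $1$ in the row of that node. Boundary spaces: $\Psi_b^1=(\Psi^1\cdot\boldsymbol n)|_{\partial\Omega}\mathbb N_1$ and $\Psi_b^0=\Psi^0|_{\partial\Omega}\mathbb N_0$ are bases of the trace spaces $D(\partial\Omega)$ and $C(\partial\Omega)$; with $\mathbb M_b^{(k)}=\int_{\partial\Omega}(\Psi_b^k)^\intercal\Psi_b^k\,\mathrm d\Gamma$, the dual bases are $\widetilde\Psi_b^{1-k}=\Psi_b^k(\mathbb M_b^{(k)})^{-1}$. Elements of $\widetilde D(\partial\Omega)$ are $\hat s^h=\widetilde\Psi_b^0\widetilde{\mathcal B}^0(\hat s^h)$ and elements of $\widetilde C(\partial\Omega)$ are $\hat d^h=\widetilde\Psi_b^1\widetilde{\mathcal B}^1(\hat d^h)$, with coefficient vectors $\widetilde{\mathcal B}^0,\widetilde{\mathcal B}^1$. Operators: $\widetilde{\mathrm{GRAD}}:\widetilde S(\Omega)\times\widetilde D(\partial\Omega)\to\widetilde D(\Omega)\times\widetilde C(\partial\Omega)$, $$\widetilde{\mathrm{GRAD}}(s^h,\hat s^h)=\Big(\widetilde\Psi^1\big(-(\mathbb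 E^{2,1})^\intercal\widetilde{\mathcal N}^0(s^h)+\mathbb N_1\widetilde{\mathcal B}^0(\hat s^h)\big),\;-\widetilde\Psi_b^1\,\mathbb N_0^\intercal(\mathbb E^{1,0})^\intercal\mathbb N_1\widetilde{\mathcal B}^0(\hat s^h)\Big),$$ and $\widetilde{\mathrm{ROT}}:\widetilde D(\Omega)\times\widetilde C(\partial\Omega)\to\widetilde C(\Omega)\times 0$, $$\widetilde{\mathrm{ROT}}(\boldsymbol d^h,\hat d^h)=\Big(\widetilde\Psi^2\big((\mathbb E^{1,0})^\intercal\widetilde{\mathcal N}^1(\boldsymbol d^h)+\mathbb N_0\widetilde{\mathcal B}^1(\hat d^h)\big),\;0\Big).$$ *)

theory Defs
  imports "HOL-Analysis.Analysis" "HOL-Computational_Algebra.Polynomial"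
begin

section \<open>Reference square, Gauss--Lobatto--Legendre nodes, polynomial spaces\<close>

type_synonym pt = "real^2"

text \<open>Rodrigues' formula.\<close>

definition legendre :: "nat \<Rightarrow> real poly" where
  "legendre N = smult (1 / (2 ^ N * fact N)) ((pderiv ^^ N) ([:-1, 0, 1:] ^ N))"

definition gll_nodes :: "nat \<Rightarrow> (nat \<Rightarrow> real) \<Rightarrow> bool" where
  "gll_nodes N \<xi> \<longleftrightarrow> \<xi> 0 = -1 \<and> \<xi> N = 1 \<and> strict_mono_on {0..N} \<xi> \<and>
     \<xi> ` {0..N} = {x. poly ([:1, 0, -1:] * pderiv (legendre N)) x = 0}"

definition ref_square :: "pt set" where
  "ref_square = cbox (vector [-1, -1]) (vector [1, 1])"

definition corners :: "pt set" where
  "corners = {z. \<forall>i. z $ i = -1 \<or> z $ i = 1}"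

text \<open>Each side of the square occurs with both orientations.\<close>

definition sides :: "(pt \<times> pt) set" where
  "sides = {(a, b). a \<in> corners \<and> b \<in> corners \<and> (\<exists>!i. a $ i \<noteq> b $ i)}"

text \<open>Tensor product of the univariate polynomials of degree at most \<open>p\<close> (first variable)
  with those of degree at most \<open>q\<close> (second variable).\<close>

definition tensor_poly :: "nat \<Rightarrow> nat \<Rightarrow> (pt \<Rightarrow> real) set" where
  "tensor_poly p q =
     {f. \<exists>c. f = (\<lambda>z. \<Sum>i\<le>p. \<Sum>j\<le>q. c i j * (z $ 1) ^ i * (z $ 2) ^ j)}"

definition C_ref :: "nat \<Rightarrow> (pt \<Rightarrow> real) set" where
  "C_ref N = tensor_poly N N"

definition D_ref :: "nat \<Rightarrow> (pt \<Rightarrow> pt) set" where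
  "D_ref N = {u. (\<lambda>z. u z $ 1) \<in> tensor_poly N (N - 1) \<and> (\<lambda>z. u z $ 2) \<in> tensor_poly (N - 1) N}"

definition S_ref :: "nat \<Rightarrow> (pt \<Rightarrow> real) set" where
  "S_ref N = tensor_poly (N - 1) (N - 1)"

section \<open>Regularity of maps and domains\<close>

text \<open>Class \<open>C\<^sup>k\<close> on an open set.\<close>

primrec Ck_on ::
  "nat \<Rightarrow> ('a::real_normed_vector \<Rightarrow> 'b::real_normed_vector) \<Rightarrow> 'a set \<Rightarrow> bool" where
  "Ck_on 0 f U \<longleftrightarrow> continuous_on U f"
| "Ck_on (Suc k) f U \<longleftrightarrow>
     f differentiable_on U \<and> (\<forall>v. Ck_on k (\<lambda>x. frechet_derivative f (at x) v) U)"

text \<open>\<open>C\<^sup>2\<close> is the least regularity for which the divergence of a mapped field is defined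
  pointwise; in particular all smooth diffeomorphisms are covered.  A diffeomorphism of a closed
  set is one that extends to an open neighbourhood.\<close>

definition diffeomorphism_near :: "pt set \<Rightarrow> (pt \<Rightarrow> pt) \<Rightarrow> bool" where
  "diffeomorphism_near A \<Phi> \<longleftrightarrow>
     (\<exists>U g. open U \<and> A \<subseteq> U \<and> open (\<Phi> ` U) \<and> Ck_on 2 \<Phi> U \<and> Ck_on 2 g (\<Phi> ` U) \<and>
            (\<forall>z\<in>U. g (\<Phi> z) = z))"

definition bounded_lipschitz_domain :: "pt set \<Rightarrow> bool" where
  "bounded_lipschitz_domain W \<longleftrightarrow> W \<noteq> {} \<and> open W \<and> connected W \<and> bounded W \<and>
     (\<forall>p\<in>frontier W. \<exists>\<tau> \<nu> h L. \<exists>r>0.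
        norm \<tau> = 1 \<and> norm \<nu> = 1 \<and> \<tau> \<bullet> \<nu> = 0 \<and> L-lipschitz_on UNIV (h :: real \<Rightarrow> real) \<and>
        (\<forall>x\<in>ball p r. x \<in> W \<longleftrightarrow> h (x \<bullet> \<tau>) < x \<bullet> \<nu>))"

text \<open>Near \<open>x\<close>, up to arbitrarily thin cones around the tangent line, the side of the tangent
  line to which \<open>\<nu>\<close> points lies outside and the other side lies inside \<open>W\<close>.\<close>

definition outward_unit_normal_at :: "pt set \<Rightarrow> pt \<Rightarrow> pt \<Rightarrow> bool" where
  "outward_unit_normal_at W x \<nu> \<longleftrightarrow> norm \<nu> = 1 \<and>
     (\<forall>\<epsilon>>0. \<exists>\<delta>>0. \<forall>y\<in>ball x \<delta>.
        ((y - x) \<bullet> \<nu> > \<epsilon> * norm (y - x) \<longrightarrow> y \<notin> closure W) \<and>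
        ((y - x) \<bullet> \<nu> < - \<epsilon> * norm (y - x) \<longrightarrow> y \<in> W))"

section \<open>Meshed domains\<close>

text \<open>The finite index types are those of the elements, nodes, small edges, small cells,
  boundary nodes and boundary small edges; \<open>node\<close>, \<open>edge\<close>, \<open>cell\<close>, \<open>bnode\<close> and \<open>bedge\<close> are
  arbitrary numberings, so that coefficient vectors and matrices are of type \<open>real^_\<close> and \<open>real^_^_\<close>.\<close>

record ('m::finite, 'n::finite, 'e::finite, 'c::finite, 'bn::finite, 'be::finite) mesh =
  degr :: nat
  gll :: "nat \<Rightarrow> real"
  region :: "pt set"
  normal :: "pt \<Rightarrow> pt"
  chart :: "'m \<Rightarrow> pt \<Rightarrow> pt"
  node :: "'n \<Rightarrow> pt"
  edge :: "'e \<Rightarrow> pt set"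
  edge_normal :: "'e \<Rightarrow> pt \<Rightarrow> pt"
  cell :: "'c \<Rightarrow> pt set"
  bnode :: "'bn \<Rightarrow> 'n"
  bedge :: "'be \<Rightarrow> 'e"

definition element where
  "element M m = chart M m ` ref_square"

definition jac where
  "jac M m z = jacobian (chart M m) (at z)"

definition grid_point :: "_ \<Rightarrow> nat \<Rightarrow> nat \<Rightarrow> pt" where
  "grid_point M i j = vector [gll M i, gll M j]"

definition ref_edges where
  "ref_edges M =
     {(grid_point M i j, grid_point M (Suc i) j) | i j. i < degr M \<and> j \<le> degr M} \<union>
     {(grid_point M i j, grid_point M i (Suc j)) | i j. i \<le> degr M \<and> j < degr M}"

definition mesh_nodes where
  "mesh_nodes M = {chart M m (grid_point M i j) | m i j. i \<le> degr M \<and> j \<le> degr M}"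

definition mesh_edges where
  "mesh_edges M =
     {path_image (chart M m \<circ> linepath a b) | m a b. (a, b) \<in> ref_edges M}"

definition mesh_cells where
  "mesh_cells M =
     {chart M m ` cbox (grid_point M i j) (grid_point M (Suc i) (Suc j)) | m i j.
        i < degr M \<and> j < degr M}"

text \<open>All representations of a small edge as the mapped grid segment of an element.  A small edge
  on the interface of two elements has two of them.\<close>

definition edge_paths where
  "edge_paths M E =
     {(m, chart M m \<circ> linepath a b) | m a b.
        (a, b) \<in> ref_edges M \<and> path_image (chart M m \<circ> linepath a b) = E}"

definition unit_normal_along where
  "unit_normal_along M E \<nu> \<longleftrightarrow> continuous_on E \<nu> \<and> (\<forall>x\<in>E. norm (\<nu> x) = 1) \<and>
     (\<forall>(m, \<gamma>)\<in>edge_paths M E. \<forall>t\<in>{0..1}. \<nu> (\<gamma> t) \<bullet> vector_derivative \<gamma> (at t) = 0)"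

text \<open>The (oriented) sides \<open>(a, b)\<close> of element \<open>m\<close> and \<open>(a', b')\<close> of element \<open>m'\<close> are glued,
  with the same parametrization from both elements.\<close>

definition glued where
  "glued M m a b m' a' b' \<longleftrightarrow> (a, b) \<in> sides \<and> (a', b') \<in> sides \<and>
     (\<forall>t\<in>{0..1}. chart M m (linepath a b t) = chart M m' (linepath a' b' t))"

definition conforming where
  "conforming M \<longleftrightarrow> (\<forall>m m'. m \<noteq> m' \<longrightarrow>
     interior (element M m) \<inter> interior (element M m') = {} \<and>
     (\<forall>x \<in> element M m \<inter> element M m'.
        (\<exists>a\<in>corners. \<exists>a'\<in>corners. x = chart M m a \<and> x = chart M m' a') \<or>
        (\<exists>a b a' b'. glued M m a b m' a' b' \<and> x \<in> path_image (chart M m \<circ> linepath a b))))"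

text \<open>The outward normal is prescribed off the mesh nodes, where the boundary is smooth.\<close>

definition meshed_domain where
  "meshed_domain M \<longleftrightarrow>
     degr M \<ge> 1 \<and> gll_nodes (degr M) (gll M) \<and>
     bounded_lipschitz_domain (region M) \<and>
     (\<forall>m. diffeomorphism_near ref_square (chart M m) \<and> (\<forall>z\<in>ref_square. det (jac M m z) > 0)) \<and>
     closure (region M) = (\<Union>m. element M m) \<and>
     conforming M \<and>
     frontier (region M) = \<Union>{E \<in> mesh_edges M. E \<subseteq> frontier (region M)} \<and>
     (\<forall>x \<in> frontier (region M) - mesh_nodes M. outward_unit_normal_at (region M) x (normal M x)) \<and>
     bij_betw (node M) UNIV (mesh_nodes M) \<and>
     bij_betw (edge M) UNIV (mesh_edges M) \<and>
     bij_betw (cell M) UNIV (mesh_cells M) \<and>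
     (\<forall>e. unit_normal_along M (edge M e) (edge_normal M e)) \<and>
     bij_betw (bnode M) UNIV {i. node M i \<in> frontier (region M)} \<and>
     bij_betw (bedge M) UNIV {e. edge M e \<subseteq> frontier (region M)}"

section \<open>Function spaces\<close>

text \<open>Fields in \<open>D\<close> and \<open>S\<close> are two-valued on element interfaces, so a piecewise field is a
  function of the element and the point.  All fields are extended by 0 off their domain, so that
  equality of fields is equality of functions.\<close>

definition C_space where
  "C_space M = {\<omega>.
     continuous_on (closure (region M)) \<omega> \<and> (\<forall>x. x \<notin> closure (region M) \<longrightarrow> \<omega> x = 0) \<and>
     (\<forall>m. \<exists>f\<in>C_ref (degr M). \<forall>z\<in>ref_square. \<omega> (chart M m z) = f z)}"

definition D_space where
  "D_space M = {q.
     (\<forall>m x. x \<notin> element M m \<longrightarrow> q (m, x) = 0) \<and>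
     (\<forall>m. \<exists>u\<in>D_ref (degr M). \<forall>z\<in>ref_square.
        q (m, chart M m z) = (1 / det (jac M m z)) *\<^sub>R (jac M m z *v u z)) \<and>
     (\<forall>m m' a b a' b'. m \<noteq> m' \<and> glued M m a b m' a' b' \<longrightarrow>
        (let \<gamma> = chart M m \<circ> linepath a b in
         \<forall>t\<in>{0..1}. \<forall>v. v \<bullet> vector_derivative \<gamma> (at t) = 0 \<longrightarrow>
           q (m, \<gamma> t) \<bullet> v = q (m', \<gamma> t) \<bullet> v))}"

definition S_space where
  "S_space M = {g.
     (\<forall>m x. x \<notin> element M m \<longrightarrow> g (m, x) = 0) \<and>
     (\<forall>m. \<exists>f\<in>S_ref (degr M). \<forall>z\<in>ref_square.
        g (m, chart M m z) = (1 / det (jac M m z)) * f z)}"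

definition curl :: "(pt \<Rightarrow> real) \<Rightarrow> pt \<Rightarrow> pt" where
  "curl \<omega> x = vector [frechet_derivative \<omega> (at x) (axis 2 1),
                     - frechet_derivative \<omega> (at x) (axis 1 1)]"

definition divergence :: "(pt \<Rightarrow> pt) \<Rightarrow> pt \<Rightarrow> real" where
  "divergence q x = (\<Sum>i\<in>UNIV. frechet_derivative q (at x) (axis i 1) $ i)"

section \<open>Integrals and degrees of freedom\<close>

text \<open>Arc-length integral over a small edge of a piecewise integrand; for integrands with the same
  value from both elements it does not depend on the representation.\<close>

definition edge_integral where
  "edge_integral M E g =
     (case (SOME p. p \<in> edge_paths M E) of (m, \<gamma>) \<Rightarrow>
        integral {0..1} (\<lambda>t. g (m, \<gamma> t) * norm (vector_derivative \<gamma> (at t))))"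

definition boundary_integral where
  "boundary_integral M h = (\<Sum>b\<in>UNIV. edge_integral M (edge M (bedge M b)) (\<lambda>(m, x). h x))"

definition dof0 where
  "dof0 M \<omega> = (\<chi> i. \<omega> (node M i))"

definition dof1 where
  "dof1 M q = (\<chi> e. edge_integral M (edge M e) (\<lambda>(m, x). q (m, x) \<bullet> edge_normal M e x))"

definition dof2 where
  "dof2 M g = (\<chi> c. integral (cell M c) (\<lambda>x. g (SOME m. cell M c \<subseteq> element M m, x)))"

section \<open>Bases, incidence matrices, mass matrices\<close>

text \<open>Row vector of functions times column vector, and times matrix.\<close>

definition expand :: "('i::finite \<Rightarrow> 'x \<Rightarrow> 'v::real_vector) \<Rightarrow> real^'i \<Rightarrow> 'x \<Rightarrow> 'v" where
  "expand \<Psi> c = (\<lambda>x. \<Sum>i\<in>UNIV. c $ i *\<^sub>R \<Psi> i x)"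

definition row_mult ::
  "('i::finite \<Rightarrow> 'x \<Rightarrow> 'v::real_vector) \<Rightarrow> real^'j^'i \<Rightarrow> 'j \<Rightarrow> 'x \<Rightarrow> 'v" where
  "row_mult \<Psi> A = (\<lambda>j. expand \<Psi> (column j A))"

definition basis_for_dofs ::
  "('x \<Rightarrow> 'v::real_vector) set \<Rightarrow> (('x \<Rightarrow> 'v) \<Rightarrow> real^'i) \<Rightarrow> ('i::finite \<Rightarrow> 'x \<Rightarrow> 'v) \<Rightarrow> bool"
  where
  "basis_for_dofs V dof \<Psi> \<longleftrightarrow> (\<forall>i. \<Psi> i \<in> V) \<and>
     (\<forall>c. expand \<Psi> c = (\<lambda>x. 0) \<longrightarrow> c = 0) \<and>
     (\<forall>f\<in>V. f = expand \<Psi> (dof f))"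

record ('m::finite, 'n::finite, 'e::finite, 'c::finite, 'bn::finite, 'be::finite) fem_mesh =
  "('m, 'n, 'e, 'c, 'bn, 'be) mesh" +
  Psi0 :: "'n \<Rightarrow> pt \<Rightarrow> real"
  Psi1 :: "'e \<Rightarrow> 'm \<times> pt \<Rightarrow> pt"
  Psi2 :: "'c \<Rightarrow> 'm \<times> pt \<Rightarrow> real"
  E10 :: "real^'n^'e"
  E21 :: "real^'e^'c"

text \<open>The derivatives are taken in the element interiors; this determines the matrices, since the
  expansions are continuous on each closed element.\<close>

definition discretization where
  "discretization M \<longleftrightarrow> meshed_domain M \<and>
     basis_for_dofs (C_space M) (dof0 M) (Psi0 M) \<and>
     basis_for_dofs (D_space M) (dof1 M) (Psi1 M) \<and>
     basis_for_dofs (S_space M) (dof2 M) (Psi2 M) \<and>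
     (\<forall>\<omega>\<in>C_space M. \<forall>m. \<forall>x\<in>interior (element M m).
        curl \<omega> x = expand (Psi1 M) (E10 M *v dof0 M \<omega>) (m, x)) \<and>
     (\<forall>q\<in>D_space M. \<forall>m. \<forall>x\<in>interior (element M m).
        divergence (\<lambda>y. q (m, y)) x = expand (Psi2 M) (E21 M *v dof1 M q) (m, x))"

definition piecewise_mass where
  "piecewise_mass M \<Psi> =
     (\<chi> i j. \<Sum>m\<in>UNIV. integral (element M m) (\<lambda>x. \<Psi> i (m, x) \<bullet> \<Psi> j (m, x)))"

definition mass0 where
  "mass0 M = (\<chi> i j. integral (region M) (\<lambda>x. Psi0 M i x * Psi0 M j x))"

definition mass1 where
  "mass1 M = piecewise_mass M (Psi1 M)"

definition mass2 where
  "mass2 M = piecewise_mass M (Psi2 M)"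

text \<open>Dual bases and degrees of freedom; the superscript is complementary to that of the primal
  ones.\<close>

definition "dual_Psi2 M = row_mult (Psi0 M) (matrix_inv (mass0 M))"
definition "dual_Psi1 M = row_mult (Psi1 M) (matrix_inv (mass1 M))"
definition "dual_dof1 M q = mass1 M *v dof1 M q"
definition "dual_dof0 M g = mass2 M *v dof2 M g"

section \<open>Boundary spaces\<close>

definition incl0 where
  "incl0 M = (\<chi> i j. if i = bnode M j then 1 else (0::real))"

definition incl1 where
  "incl1 M = (\<chi> e b. if e = bedge M b then
                       (if \<forall>x \<in> edge M e - mesh_nodes M. edge_normal M e x = normal M x
                        then 1 else -1)
                     else (0::real))"

definition trace where
  "trace M \<omega> x = (if x \<in> frontier (region M) then \<omega> x else 0)"

text \<open>Normal traces are defined up to the (finitely many) nodes, where they are set to 0.\<close>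

definition normal_trace where
  "normal_trace M q x =
     (if x \<in> frontier (region M) - mesh_nodes M
      then q (SOME m. x \<in> element M m, x) \<bullet> normal M x else 0)"

definition "C_bd_space M = trace M ` C_space M"
definition "D_bd_space M = normal_trace M ` D_space M"

definition "Psi_b0 M = row_mult (\<lambda>i. trace M (Psi0 M i)) (incl0 M)"
definition "Psi_b1 M = row_mult (\<lambda>e. normal_trace M (Psi1 M e)) (incl1 M)"

definition boundary_mass where
  "boundary_mass M \<Psi> = (\<chi> i j. boundary_integral M (\<lambda>x. \<Psi> i x * \<Psi> j x))"

definition "dual_Psi_b1 M = row_mult (Psi_b0 M) (matrix_inv (boundary_mass M (Psi_b0 M)))"
definition "dual_Psi_b0 M = row_mult (Psi_b1 M) (matrix_inv (boundary_mass M (Psi_b1 M)))"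

text \<open>Coefficient vectors in the dual boundary bases.\<close>

definition "bd_coeff0 M s = (THE b. s = expand (dual_Psi_b0 M) b)"
definition "bd_coeff1 M d = (THE b. d = expand (dual_Psi_b1 M) b)"

section \<open>Dual spaces and operators\<close>

text \<open>As sets of functions the dual spaces are the primal ones, only the bases differ.\<close>

definition "dual_S_space M = S_space M"
definition "dual_D_space M = D_space M"
definition "dual_C_bd_space M = C_bd_space M"
definition "dual_D_bd_space M = D_bd_space M"

definition GRAD where
  "GRAD M = (\<lambda>(s, s').
     (expand (dual_Psi1 M)
        (- (transpose (E21 M) *v dual_dof0 M s) + incl1 M *v bd_coeff0 M s'),
      expand (dual_Psi_b1 M)
        (- ((transpose (incl0 M) ** transpose (E10 M) ** incl1 M) *v bd_coeff0 M s'))))"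

definition ROT where
  "ROT M = (\<lambda>(d, d').
     (expand (dual_Psi2 M)
        (transpose (E10 M) *v dual_dof1 M d + incl0 M *v bd_coeff1 M d'),
      \<lambda>x::pt. 0::real))"

end

theory Submission
  imports Defs
begin

text \<open>With \<open>n\<close> and \<open>b\<close> the coefficient vectors of the two arguments, the coefficient vector of
  \<open>ROT (GRAD (s, s'))\<close> is \<open>- E10\<^sup>T E21\<^sup>T n + (1 - N0 N0\<^sup>T) E10\<^sup>T N1 b\<close>, once the mass matrices of \<open>D\<close> and of
  the boundary nodes are known to be invertible, so that they cancel against the dual bases.
  The first term vanishes because \<open>div curl = 0\<close> forces \<open>E21 E10 = 0\<close>.  The second vanishes because
  \<open>N0 N0\<^sup>T\<close> is the projection onto the boundary nodes and \<open>E10\<close> does not couple a boundary edge to a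
  node off the boundary: the flux of \<open>curl \<omega>\<close> through an edge is, up to sign, the difference of \<open>\<omega>\<close> at
  the two end points.\<close>

section \<open>Expansions and matrices\<close>

text \<open>\<open>discretization\<close> describes the incidence matrices only through functions:
  curls and divergences agree with expansions inside the elements. Entries and products are
  therefore recovered by choosing a function, computing pointwise and comparing degrees of freedom.
  Since functions in \<open>C_space M\<close> are only piecewise smooth, each pointwise computation
  takes place on the image of the open square, and continuity on the closed element carries the
  result to the sides, where the fluxes live. The dual bases are formed with
  \<open>matrix_inv\<close> and the boundary coefficients with THE; both acquire their meaning only
  through injectivity. Each mass matrix that is inverted here is a Gram matrix, so a kernel vector
  yields a field with zero L2 norm, which vanishes by continuity.\<close>

lemma expand_diff: "expand \<Psi> (c - d) = (\<lambda>x. expand \<Psi> c x - expand \<Psi> d x)"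
  by (simp add: expand_def scaleR_diff_left sum_subtractf)

lemma expand_zero: "expand \<Psi> 0 = (\<lambda>x. 0)"
  by (simp add: expand_def)

lemma expand_axis: "expand \<Psi> (axis i 1) = \<Psi> i"
  by (rule ext) (simp add: expand_def axis_def if_distrib [where f = "\<lambda>a. a *\<^sub>R _"] cong: if_cong)

lemma expand_row_mult: "expand (row_mult \<Psi> A) c = expand \<Psi> (A *v c)"
proof
  fix x
  have "expand (row_mult \<Psi> A) c x = (\<Sum>j\<in>UNIV. \<Sum>i\<in>UNIV. (c $ j * A $ i $ j) *\<^sub>R \<Psi> i x)"
    by (simp add: expand_def row_mult_def column_def scaleR_sum_right)
  also have "\<dots> = (\<Sum>i\<in>UNIV. \<Sum>j\<in>UNIV. (c $ j * A $ i $ j) *\<^sub>R \<Psi> i x)"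
    by (rule sum.swap)
  also have "\<dots> = expand \<Psi> (A *v c) x"
    by (simp add: expand_def matrix_vector_mult_def scaleR_sum_left mult.commute)
  finally show "expand (row_mult \<Psi> A) c x = expand \<Psi> (A *v c) x" .
qed

lemma expand_in_space:
  assumes zero: "(\<lambda>x. 0) \<in> V"
    and add: "\<And>f g. f \<in> V \<Longrightarrow> g \<in> V \<Longrightarrow> (\<lambda>x. f x + g x) \<in> V"
    and scale: "\<And>a f. f \<in> V \<Longrightarrow> (\<lambda>x. a *\<^sub>R f x) \<in> V"
    and \<Psi>: "\<And>i. \<Psi> i \<in> V"
  shows "expand \<Psi> c \<in> V"
proof -
  have "(\<lambda>x. \<Sum>i\<in>I. c $ i *\<^sub>R \<Psi> i x) \<in> V" if "finite I" for I
    using that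
  proof induction
    case (insert i I)
    then show ?case
      using add [OF scale [OF \<Psi>] insert.IH, of "c $ i" i] by simp
  qed (simp add: zero)
  then show ?thesis
    by (simp add: expand_def)
qed

text \<open>\<open>dof\<close> is not assumed linear. Reproduction on \<open>V\<close> gives
  \<open>expand \<Psi> c\<close> a second coefficient vector, its own degrees of freedom, and
  independence identifies the two.\<close>

lemma dof_expand:
  assumes "basis_for_dofs V dof \<Psi>" "expand \<Psi> c \<in> V"
  shows "dof (expand \<Psi> c) = c"
proof -
  have "expand \<Psi> (dof (expand \<Psi> c) - c) = (\<lambda>x. 0)"
    using assms by (simp add: basis_for_dofs_def expand_diff)
  then have "dof (expand \<Psi> c) - c = 0"
    using assms(1) unfolding basis_for_dofs_def by blast
  then show ?thesis by simp
qed

text \<open>\<open>matrix_inv\<close> is a choice, an inverse only if one exists; for a square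
  matrix a trivial kernel provides a left inverse, which is two-sided.\<close>

lemma matrix_inv_of_injective:
  fixes A :: "real^'n^'n"
  assumes "\<And>c. A *v c = 0 \<Longrightarrow> c = 0"
  shows "A *v (matrix_inv A *v v) = v"
proof -
  have "invertible A"
    using assms matrix_left_invertible_ker invertible_left_inverse by blast
  then have "A ** matrix_inv A = mat 1"
    unfolding invertible_def matrix_inv_def by (metis (mono_tags, lifting) someI_ex)
  then show ?thesis
    by (simp add: matrix_vector_mul_assoc)
qed

section \<open>Second derivatives and vanishing integrals\<close>

text \<open>The mean value theorem along \<open>v\<close>, applied to the increment of
  \<open>F\<close> in direction \<open>w\<close>, turns the second difference into \<open>t\<close>
  times a difference of two values of \<open>F' _ v\<close>; the differential \<open>A\<close> of
  that map at \<open>x\<close> evaluates this up to o(t).\<close>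

lemma second_difference_estimate:
  fixes F :: "'a::real_normed_vector \<Rightarrow> real"
  assumes U: "open U" "x \<in> U"
    and F: "\<And>y. y \<in> U \<Longrightarrow> (F has_derivative F' y) (at y)"
    and A: "((\<lambda>y. F' y v) has_derivative A) (at x)"
    and "e > 0"
  shows "eventually (\<lambda>t. \<bar>F (x + t *\<^sub>R v + t *\<^sub>R w) - F (x + t *\<^sub>R v) - F (x + t *\<^sub>R w) + F x - t\<^sup>2 * A w\<bar>
           \<le> e * t\<^sup>2) (at_right (0::real))"
proof -
  \<comment> \<open>\<open>t * n\<close> bounds the distance from \<open>x\<close> to every point of
    the parallelogram; the summand 1 keeps \<open>n\<close> positive when both directions
    vanish.\<close>
  define n where "n = norm v + norm w + 1"
  have n: "n > 0" by (simp add: n_def add_nonneg_pos)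
  obtain r where r: "r > 0" "ball x r \<subseteq> U"
    using U open_contains_ball by blast
  \<comment> \<open>Tolerance \<open>e / (2 * n)\<close> over distances up to \<open>t * n\<close>
    costs \<open>e / 2 * t\<close> at each of the two points compared below, hence
    \<open>e * t\<close> in total.\<close>
  obtain d where d: "d > 0"
    "\<And>y. norm (y - x) < d \<Longrightarrow> norm (F' y v - F' x v - A (y - x)) \<le> e / (2 * n) * norm (y - x)"
    using A[unfolded has_derivative_at_alt] \<open>e > 0\<close> n
    by (metis divide_pos_pos mult_pos_pos zero_less_numeral)
  have linA: "linear A" using A has_derivative_linear by blast
  have "\<bar>F (x + t *\<^sub>R v + t *\<^sub>R w) - F (x + t *\<^sub>R v) - F (x + t *\<^sub>R w) + F x - t\<^sup>2 * A w\<bar> \<le> e * t\<^sup>2"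
    if t: "0 < t" "t < min r d / n" for t
  proof -
    have tn: "t * n < r" "t * n < d"
      using t n by (simp_all add: field_simps)
    have small: "norm (s *\<^sub>R v + u *\<^sub>R w) \<le> t * n" if "0 \<le> s" "s \<le> t" "0 \<le> u" "u \<le> t" for s u
    proof -
      have "norm (s *\<^sub>R v + u *\<^sub>R w) \<le> s * norm v + u * norm w"
        using that norm_triangle_ineq[of "s *\<^sub>R v" "u *\<^sub>R w"] by simp
      also have "\<dots> \<le> t * norm v + t * norm w"
        using that by (intro add_mono mult_right_mono) auto
      also have "\<dots> \<le> t * n" using t by (simp add: n_def algebra_simps)
      finally show ?thesis .
    qed
    have inU: "x + s *\<^sub>R v + u *\<^sub>R w \<in> U" if "0 \<le> s" "s \<le> t" "0 \<le> u" "u \<le> t" for s u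
    proof -
      have "dist x (x + s *\<^sub>R v + u *\<^sub>R w) = norm (s *\<^sub>R v + u *\<^sub>R w)"
        by (metis add.assoc add_diff_cancel_left' dist_commute dist_norm)
      then show ?thesis
        using small[OF that] tn r by (auto simp: subset_iff)
    qed
    \<comment> \<open>Writing \<open>0 *\<^sub>R w\<close> makes both terms instances of the path in
      \<open>der\<close>, with \<open>u = t\<close> and \<open>u = 0\<close>.\<close>
    define \<phi> where "\<phi> s = F (x + s *\<^sub>R v + t *\<^sub>R w) - F (x + s *\<^sub>R v + 0 *\<^sub>R w)" for s
    have der: "((\<lambda>s. F (x + s *\<^sub>R v + u *\<^sub>R w)) has_real_derivative F' (x + s *\<^sub>R v + u *\<^sub>R w) v) (at s)"
      if "0 \<le> s" "s \<le> t" "0 \<le> u" "u \<le> t" for s u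
    proof -
      have "((\<lambda>s. x + s *\<^sub>R v + u *\<^sub>R w) has_derivative (\<lambda>h. h *\<^sub>R v)) (at s)"
        by (auto intro!: derivative_eq_intros)
      from has_derivative_compose[OF this F[OF inU[OF that]]]
      show ?thesis
        unfolding has_field_derivative_def
        by (rule has_derivative_eq_rhs)
          (simp add: fun_eq_iff mult.commute linear_scale[OF has_derivative_linear[OF F[OF inU[OF that]]]])
    qed
    have "(\<phi> has_real_derivative F' (x + s *\<^sub>R v + t *\<^sub>R w) v - F' (x + s *\<^sub>R v + 0 *\<^sub>R w) v) (at s)"
      if "0 \<le> s" "s \<le> t" for s
      unfolding \<phi>_def using that t by (intro DERIV_diff der) auto
    from MVT2[OF \<open>0 < t\<close> this]
    obtain s where s: "0 < s" "s < t"
      "\<phi> t - \<phi> 0 = t * (F' (x + s *\<^sub>R v + t *\<^sub>R w) v - F' (x + s *\<^sub>R v + 0 *\<^sub>R w) v)"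
      by auto
    have app: "\<bar>F' (x + s *\<^sub>R v + u *\<^sub>R w) v - F' x v - A (s *\<^sub>R v + u *\<^sub>R w)\<bar> \<le> e / 2 * t"
      if "0 \<le> u" "u \<le> t" for u
    proof -
      have "norm (s *\<^sub>R v + u *\<^sub>R w) \<le> t * n" using small s that by simp
      moreover from this have "\<bar>F' (x + s *\<^sub>R v + u *\<^sub>R w) v - F' x v - A (s *\<^sub>R v + u *\<^sub>R w)\<bar>
          \<le> e / (2 * n) * norm (s *\<^sub>R v + u *\<^sub>R w)"
        using d(2)[of "x + s *\<^sub>R v + u *\<^sub>R w"] tn by (simp add: add.assoc)
      ultimately have "\<bar>F' (x + s *\<^sub>R v + u *\<^sub>R w) v - F' x v - A (s *\<^sub>R v + u *\<^sub>R w)\<bar>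
          \<le> e / (2 * n) * (t * n)"
        using \<open>e > 0\<close> n by (meson order_trans mult_left_mono divide_nonneg_nonneg less_imp_le mult_nonneg_nonneg zero_le_numeral)
      also have "\<dots> = e / 2 * t" using n by simp
      finally show ?thesis .
    qed
    have "A (s *\<^sub>R v + t *\<^sub>R w) - A (s *\<^sub>R v + 0 *\<^sub>R w) = t * A w"
      by (simp add: linear_add[OF linA] linear_scale[OF linA])
    then have "\<bar>(F' (x + s *\<^sub>R v + t *\<^sub>R w) v - F' (x + s *\<^sub>R v + 0 *\<^sub>R w) v) - t * A w\<bar> \<le> e * t"
      using app[of t] app[of 0] t unfolding abs_le_iff by linarith
    then have "t * \<bar>(F' (x + s *\<^sub>R v + t *\<^sub>R w) v - F' (x + s *\<^sub>R v + 0 *\<^sub>R w) v) - t * A w\<bar> \<le> t * (e * t)"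
      using t by (intro mult_left_mono) auto
    moreover have "\<phi> t - \<phi> 0 - t\<^sup>2 * A w
        = t * ((F' (x + s *\<^sub>R v + t *\<^sub>R w) v - F' (x + s *\<^sub>R v + 0 *\<^sub>R w) v) - t * A w)"
      unfolding s(3) by (simp add: power2_eq_square right_diff_distrib)
    ultimately have "\<bar>\<phi> t - \<phi> 0 - t\<^sup>2 * A w\<bar> \<le> e * t\<^sup>2"
      using t by (simp only: abs_mult abs_of_pos power2_eq_square mult_ac)
    then show ?thesis
      by (simp add: \<phi>_def algebra_simps)
  qed
  moreover have "min r d / n > 0" using r d n by simp
  ultimately show ?thesis
    unfolding eventually_at_right_field by blast
qed

text \<open>The second difference over a small parallelogram is symmetric in the two directions.\<close>

lemma second_derivative_symmetric:
  fixes F :: "'a::real_normed_vector \<Rightarrow> real"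
  assumes U: "open U" "x \<in> U"
    and F: "\<And>y. y \<in> U \<Longrightarrow> (F has_derivative F' y) (at y)"
    and A: "((\<lambda>y. F' y v) has_derivative A) (at x)"
    and B: "((\<lambda>y. F' y w) has_derivative B) (at x)"
  shows "A w = B v"
proof (rule ccontr)
  assume "A w \<noteq> B v"
  \<comment> \<open>One third of the gap: both estimates concern the same second difference, so
    together they bound the gap by \<open>2 * e\<close>, which is too small.\<close>
  define e where "e = \<bar>A w - B v\<bar> / 3"
  have "e > 0" using \<open>A w \<noteq> B v\<close> by (simp add: e_def)
  note estA = second_difference_estimate[where F = F and F' = F' and v = v and w = w, OF U _ A \<open>e > 0\<close>]
  note estB = second_difference_estimate[where F = F and F' = F' and v = w and w = v, OF U _ B \<open>e > 0\<close>]
  have "eventually (\<lambda>t::real. \<bar>F (x + t *\<^sub>R v + t *\<^sub>R w) - F (x + t *\<^sub>R v) - F (x + t *\<^sub>R w) + F x - t\<^sup>2 * A w\<bar>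
           \<le> e * t\<^sup>2) (at_right 0)" (is "eventually ?P _")
    by (rule estA) (rule F)
  moreover have "eventually (\<lambda>t::real. \<bar>F (x + t *\<^sub>R w + t *\<^sub>R v) - F (x + t *\<^sub>R w) - F (x + t *\<^sub>R v) + F x - t\<^sup>2 * B v\<bar>
           \<le> e * t\<^sup>2) (at_right 0)" (is "eventually ?Q _")
    by (rule estB) (rule F)
  ultimately have "eventually (\<lambda>t::real. ?P t \<and> ?Q t \<and> 0 < t) (at_right 0)"
    using eventually_at_right_less[of "0::real"] by (simp add: eventually_conj_iff)
  then obtain t where t: "?P t" "?Q t" "0 < t"
    using eventually_happens[of _ "at_right (0::real)"] by force
  have "\<bar>t\<^sup>2 * A w - t\<^sup>2 * B v\<bar> \<le> 2 * (e * t\<^sup>2)"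
    using t(1,2) unfolding abs_le_iff add.assoc add.commute[of "t *\<^sub>R w"] by linarith
  then have "t\<^sup>2 * \<bar>A w - B v\<bar> \<le> t\<^sup>2 * (2 * e)"
    by (metis abs_mult abs_power2 mult.commute mult.left_commute right_diff_distrib)
  then have "\<bar>A w - B v\<bar> \<le> 2 * e" using \<open>0 < t\<close> by simp
  then show False using \<open>e > 0\<close> by (simp add: e_def)
qed

lemma integrable_on_compact:
  fixes f :: "'a::euclidean_space \<Rightarrow> real"
  assumes "compact K" "continuous_on K f"
  shows "f integrable_on K"
proof -
  have "set_integrable lborel K f"
    using borel_integrable_compact[OF assms] by (simp add: set_integrable_def)
  then show ?thesis by (rule set_borel_integral_eq_integral)
qed

text \<open>On a box inside \<open>W\<close> the integral is squeezed between 0 and the integral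
  over \<open>K\<close>, so the continuous nonnegative integrand vanishes there. A box around a
  boundary point would leave \<open>K\<close>; such points are reached by density of
  \<open>W\<close>.\<close>

lemma integral_eq_0_imp_zero:
  fixes f :: "'a::euclidean_space \<Rightarrow> real"
  assumes K: "compact K" "continuous_on K f" and nn: "\<And>x. x \<in> K \<Longrightarrow> 0 \<le> f x"
    and W: "open W" "W \<subseteq> K" "K \<subseteq> closure W"
    and "integral K f = 0" "x \<in> K"
  shows "f x = 0"
proof -
  have "f y = 0" if y: "y \<in> W" for y
  proof -
    obtain a b where ab: "y \<in> box a b" "cbox a b \<subseteq> W"
      by (rule open_contains_cbox[OF W(1) y])
    have c: "continuous_on (cbox a b) f"
      using K(2) ab W(2) continuous_on_subset by blast
    then have i: "f integrable_on cbox a b" by (rule integrable_continuous)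
    have "integral (cbox a b) f \<le> integral K f"
      using ab W(2) nn i integrable_on_compact[OF K] by (intro integral_subset_le) auto
    moreover have "0 \<le> integral (cbox a b) f"
      using ab W(2) nn by (intro integral_nonneg i) auto
    ultimately have "(f has_integral 0) (cbox a b)"
      using i \<open>integral K f = 0\<close> by (metis antisym has_integral_integral)
    moreover have "y \<in> cbox a b" using ab(1) box_subset_cbox by blast
    moreover have "\<And>z. z \<in> box a b \<Longrightarrow> 0 \<le> f z"
      using ab W(2) nn box_subset_cbox by blast
    ultimately show ?thesis
      using has_integral_0_cbox_imp_0[OF c] ab(1) by blast
  qed
  moreover have "closure W = K"
    using W K(1) compact_imp_closed closure_minimal by blast
  ultimately show ?thesis
    using continuous_constant_on_closure[of W f 0 x] K(2) \<open>x \<in> K\<close> by simp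
qed

section \<open>Finite element spaces and charts\<close>

lemma tensor_poly_0: "(\<lambda>z. 0) \<in> tensor_poly p q"
  unfolding tensor_poly_def by (auto intro!: exI[of _ "\<lambda>i j. 0"])

lemma tensor_poly_add:
  assumes "f \<in> tensor_poly p q" "g \<in> tensor_poly p q"
  shows "(\<lambda>z. f z + g z) \<in> tensor_poly p q"
proof -
  from assms obtain c d where
    "f = (\<lambda>z. \<Sum>i\<le>p. \<Sum>j\<le>q. c i j * (z $ 1) ^ i * (z $ 2) ^ j)"
    "g = (\<lambda>z. \<Sum>i\<le>p. \<Sum>j\<le>q. d i j * (z $ 1) ^ i * (z $ 2) ^ j)"
    unfolding tensor_poly_def by auto
  then show ?thesis
    unfolding tensor_poly_def
    by (auto intro!: exI[of _ "\<lambda>i j. c i j + d i j"] simp: sum.distrib distrib_right)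
qed

lemma tensor_poly_scale:
  assumes "f \<in> tensor_poly p q"
  shows "(\<lambda>z. a * f z) \<in> tensor_poly p q"
proof -
  from assms obtain c where
    "f = (\<lambda>z. \<Sum>i\<le>p. \<Sum>j\<le>q. c i j * (z $ 1) ^ i * (z $ 2) ^ j)"
    unfolding tensor_poly_def by auto
  then show ?thesis
    unfolding tensor_poly_def
    by (auto intro!: exI[of _ "\<lambda>i j. a * c i j"] simp: sum_distrib_left mult.assoc)
qed

text \<open>The second differentiability is stated direction by direction, with \<open>v\<close>
  fixed, as the product and chain rules in \<open>C_space_smooth\<close> require.\<close>

lemma tensor_poly_smooth:
  assumes "f \<in> tensor_poly p q"
  obtains f' where "\<And>z. (f has_derivative f' z) (at z)" "\<And>v z. (\<lambda>z. f' z v) differentiable (at z)"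
proof -
  from assms obtain c where f: "f = (\<lambda>z. \<Sum>i\<le>p. \<Sum>j\<le>q. c i j * (z $ 1) ^ i * (z $ 2) ^ j)"
    unfolding tensor_poly_def by auto
  \<comment> \<open>For \<open>i = 0\<close> the truncated exponent \<open>i - 1\<close> is
    harmless, since the factor \<open>of_nat i\<close> vanishes; likewise for
    \<open>j\<close>.\<close>
  define f' where "f' z v = (\<Sum>i\<le>p. \<Sum>j\<le>q. c i j *
      (of_nat i * (z $ 1) ^ (i - 1) * (z $ 2) ^ j * v $ 1 + of_nat j * (z $ 1) ^ i * (z $ 2) ^ (j - 1) * v $ 2))"
    for z v :: pt
  have nth: "((\<lambda>z::pt. z $ k) has_derivative (\<lambda>v. v $ k)) (at z)" for k z
    by (rule bounded_linear_imp_has_derivative) (rule bounded_linear_vec_nth)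
  have d: "(\<lambda>z::pt. z $ k) differentiable (at z)" for k z
    using nth differentiable_def by blast
  show ?thesis
  proof (rule that)
    show "(f has_derivative f' z) (at z)" for z
      unfolding f f'_def
      by (auto intro!: derivative_eq_intros nth sum.cong simp: algebra_simps)
    show "(\<lambda>z. f' z v) differentiable (at z)" for v z
      unfolding f'_def
      by (intro differentiable_sum ballI differentiable_mult differentiable_add differentiable_power d
          differentiable_const finite_atMost)
  qed
qed

lemma tensor_poly_continuous:
  assumes "f \<in> tensor_poly p q"
  shows "continuous_on S f"
proof -
  obtain f' where "\<And>z. (f has_derivative f' z) (at z)"
    by (rule tensor_poly_smooth[OF assms]) (rule that)
  then have "continuous (at z) f" for z
    by (rule has_derivative_continuous)
  then show ?thesis
    by (simp add: continuous_at_imp_continuous_on)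
qed

lemma C_space_pullback:
  assumes "\<omega> \<in> C_space M"
  obtains f where "f \<in> C_ref (degr M)" "\<forall>z\<in>ref_square. \<omega> (chart M m z) = f z"
  using assms that by (simp add: C_space_def) blast

lemma C_space_closed:
  "(\<lambda>x. 0) \<in> C_space M"
  "\<omega> \<in> C_space M \<Longrightarrow> \<omega>' \<in> C_space M \<Longrightarrow> (\<lambda>x. \<omega> x + \<omega>' x) \<in> C_space M"
  "\<omega> \<in> C_space M \<Longrightarrow> (\<lambda>x. a *\<^sub>R \<omega> x) \<in> C_space M"
proof -
  show "(\<lambda>x. 0) \<in> C_space M"
  proof -
    have "\<exists>f\<in>C_ref (degr M). \<forall>z\<in>ref_square. f z = 0"
      unfolding C_ref_def by (rule bexI[OF _ tensor_poly_0]) simp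
    then show ?thesis by (auto simp: C_space_def)
  qed
  show "(\<lambda>x. \<omega> x + \<omega>' x) \<in> C_space M" if \<omega>: "\<omega> \<in> C_space M" "\<omega>' \<in> C_space M"
  proof -
    have "\<exists>f\<in>C_ref (degr M). \<forall>z\<in>ref_square. \<omega> (chart M m z) + \<omega>' (chart M m z) = f z" for m
    proof -
      obtain f where "f \<in> C_ref (degr M)" "\<forall>z\<in>ref_square. \<omega> (chart M m z) = f z"
        by (rule C_space_pullback[where m = m, OF \<omega>(1)])
      moreover obtain f' where "f' \<in> C_ref (degr M)" "\<forall>z\<in>ref_square. \<omega>' (chart M m z) = f' z"
        by (rule C_space_pullback[where m = m, OF \<omega>(2)])
      ultimately show ?thesis
        unfolding C_ref_def by (intro bexI[of _ "\<lambda>z. f z + f' z"] tensor_poly_add) auto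
    qed
    then show ?thesis
      using \<omega> by (simp add: C_space_def continuous_on_add)
  qed
  show "(\<lambda>x. a *\<^sub>R \<omega> x) \<in> C_space M" if \<omega>: "\<omega> \<in> C_space M"
  proof -
    have "\<exists>f\<in>C_ref (degr M). \<forall>z\<in>ref_square. a * \<omega> (chart M m z) = f z" for m
    proof -
      obtain f where "f \<in> C_ref (degr M)" "\<forall>z\<in>ref_square. \<omega> (chart M m z) = f z"
        by (rule C_space_pullback[where m = m, OF \<omega>])
      then show ?thesis
        unfolding C_ref_def by (intro bexI[of _ "\<lambda>z. a * f z"] tensor_poly_scale) auto
    qed
    then show ?thesis
      using \<omega> by (simp add: C_space_def continuous_on_mult_left)
  qed
qed

text \<open>With the \<open>let\<close> unfolded, the three conditions can be split and instantiated
  one at a time.\<close>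

lemma D_space_iff:
  "q \<in> D_space M \<longleftrightarrow>
     (\<forall>m x. x \<notin> element M m \<longrightarrow> q (m, x) = 0) \<and>
     (\<forall>m. \<exists>u\<in>D_ref (degr M). \<forall>z\<in>ref_square.
        q (m, chart M m z) = (1 / det (jac M m z)) *\<^sub>R (jac M m z *v u z)) \<and>
     (\<forall>m m' a b a' b'. m \<noteq> m' \<and> glued M m a b m' a' b' \<longrightarrow> (\<forall>t\<in>{0..1}. \<forall>v.
        v \<bullet> vector_derivative (chart M m \<circ> linepath a b) (at t) = 0 \<longrightarrow>
        q (m, (chart M m \<circ> linepath a b) t) \<bullet> v = q (m', (chart M m \<circ> linepath a b) t) \<bullet> v))"
  unfolding D_space_def Let_def mem_Collect_eq by (rule refl)

lemma D_space_pullback: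
  assumes "q \<in> D_space M"
  obtains u where "u \<in> D_ref (degr M)"
    "\<forall>z\<in>ref_square. q (m, chart M m z) = (1 / det (jac M m z)) *\<^sub>R (jac M m z *v u z)"
proof -
  have "\<forall>m. \<exists>u\<in>D_ref (degr M). \<forall>z\<in>ref_square.
      q (m, chart M m z) = (1 / det (jac M m z)) *\<^sub>R (jac M m z *v u z)"
    using assms unfolding D_space_iff by (elim conjE)
  from spec[OF this, of m] show thesis
    using that by (elim bexE)
qed

lemma D_space_normal_continuous:
  assumes "q \<in> D_space M" "m \<noteq> m' \<and> glued M m a b m' a' b'" "t \<in> {0..1}"
    "v \<bullet> vector_derivative (chart M m \<circ> linepath a b) (at t) = 0"
  shows "q (m, (chart M m \<circ> linepath a b) t) \<bullet> v = q (m', (chart M m \<circ> linepath a b) t) \<bullet> v"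
proof -
  have "\<forall>m m' a b a' b'. m \<noteq> m' \<and> glued M m a b m' a' b' \<longrightarrow> (\<forall>t\<in>{0..1}. \<forall>v.
      v \<bullet> vector_derivative (chart M m \<circ> linepath a b) (at t) = 0 \<longrightarrow>
      q (m, (chart M m \<circ> linepath a b) t) \<bullet> v = q (m', (chart M m \<circ> linepath a b) t) \<bullet> v)"
    using assms(1) unfolding D_space_iff by (elim conjE)
  from this[THEN spec[of _ m], THEN spec[of _ m'], THEN spec[of _ a], THEN spec[of _ b], THEN spec[of _ a'],
      THEN spec[of _ b'], THEN mp, OF assms(2), THEN bspec, OF assms(3), THEN spec[of _ v], THEN mp, OF assms(4)]
  show ?thesis .
qed

text \<open>The Piola transform is linear in the reference field, and normal continuity is linear in
  the field for each glued pair of sides and each fixed \<open>v\<close>.\<close>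

lemma D_space_closed:
  "(\<lambda>x. 0) \<in> D_space M"
  "q \<in> D_space M \<Longrightarrow> q' \<in> D_space M \<Longrightarrow> (\<lambda>x. q x + q' x) \<in> D_space M"
  "q \<in> D_space M \<Longrightarrow> (\<lambda>x. a *\<^sub>R q x) \<in> D_space M"
proof -
  have "(\<lambda>z. 0) \<in> D_ref N" for N
    by (simp add: D_ref_def tensor_poly_0)
  then have "\<exists>u\<in>D_ref (degr M). \<forall>z\<in>ref_square. 0 = (1 / det (jac M m z)) *\<^sub>R (jac M m z *v u z)" for m
    by (rule bexI[rotated]) simp
  then show "(\<lambda>x. 0) \<in> D_space M"
    unfolding D_space_iff by (intro conjI allI impI ballI) (assumption | simp)+
  show "(\<lambda>x. q x + q' x) \<in> D_space M" if q: "q \<in> D_space M" "q' \<in> D_space M"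
  proof -
    have "\<exists>u\<in>D_ref (degr M). \<forall>z\<in>ref_square.
        q (m, chart M m z) + q' (m, chart M m z) = (1 / det (jac M m z)) *\<^sub>R (jac M m z *v u z)" for m
    proof -
      obtain u where u: "u \<in> D_ref (degr M)"
        "\<forall>z\<in>ref_square. q (m, chart M m z) = (1 / det (jac M m z)) *\<^sub>R (jac M m z *v u z)"
        by (rule D_space_pullback[where m = m, OF q(1)])
      obtain u' where u': "u' \<in> D_ref (degr M)"
        "\<forall>z\<in>ref_square. q' (m, chart M m z) = (1 / det (jac M m z)) *\<^sub>R (jac M m z *v u' z)"
        by (rule D_space_pullback[where m = m, OF q(2)])
      have "(\<lambda>z. u z + u' z) \<in> D_ref (degr M)"
        using u(1) u'(1) by (simp add: D_ref_def tensor_poly_add)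
      then show ?thesis
        by (rule bexI[rotated]) (simp add: u(2) u'(2) matrix_vector_right_distrib scaleR_right_distrib)
    qed
    moreover have "q (m, x) + q' (m, x) = 0" if "x \<notin> element M m" for m x
      using q that by (simp add: D_space_def)
    ultimately show ?thesis
      unfolding D_space_iff
      by (intro conjI allI impI ballI)
        (assumption | simp only: inner_add_left, (intro arg_cong2[where f = plus] q[THEN D_space_normal_continuous]; assumption))+
  qed
  show "(\<lambda>x. a *\<^sub>R q x) \<in> D_space M" if q: "q \<in> D_space M"
  proof -
    have "\<exists>u\<in>D_ref (degr M). \<forall>z\<in>ref_square.
        a *\<^sub>R q (m, chart M m z) = (1 / det (jac M m z)) *\<^sub>R (jac M m z *v u z)" for m
    proof -
      obtain u where u: "u \<in> D_ref (degr M)"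
        "\<forall>z\<in>ref_square. q (m, chart M m z) = (1 / det (jac M m z)) *\<^sub>R (jac M m z *v u z)"
        by (rule D_space_pullback[where m = m, OF q])
      have "(\<lambda>z. a *\<^sub>R u z) \<in> D_ref (degr M)"
        using u(1) by (simp add: D_ref_def tensor_poly_scale)
      then show ?thesis
        by (rule bexI[rotated]) (simp add: u(2) matrix_vector_mult_scaleR)
    qed
    moreover have "a *\<^sub>R q (m, x) = 0" if "x \<notin> element M m" for m x
      using q that by (simp add: D_space_def)
    ultimately show ?thesis
      unfolding D_space_iff
      by (intro conjI allI impI ballI)
        (assumption | simp only: inner_scaleR_left, (intro arg_cong2[where f = times] refl q[THEN D_space_normal_continuous]; assumption))+
  qed
qed

lemma S_space_pullback:
  assumes "g \<in> S_space M"
  obtains f where "f \<in> S_ref (degr M)" "\<forall>z\<in>ref_square. g (m, chart M m z) = (1 / det (jac M m z)) * f z"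
  using assms that unfolding S_space_def mem_Collect_eq by metis

lemma S_space_closed:
  "(\<lambda>x. 0) \<in> S_space M"
  "g \<in> S_space M \<Longrightarrow> g' \<in> S_space M \<Longrightarrow> (\<lambda>x. g x + g' x) \<in> S_space M"
  "g \<in> S_space M \<Longrightarrow> (\<lambda>x. a *\<^sub>R g x) \<in> S_space M"
proof -
  show "(\<lambda>x. 0) \<in> S_space M"
  proof -
    have "\<exists>f\<in>S_ref (degr M). \<forall>z\<in>ref_square. f z = 0"
      unfolding S_ref_def by (rule bexI[OF _ tensor_poly_0]) simp
    then show ?thesis by (auto simp: S_space_def)
  qed
  show "(\<lambda>x. g x + g' x) \<in> S_space M" if g: "g \<in> S_space M" "g' \<in> S_space M"
  proof -
    have "\<exists>f\<in>S_ref (degr M). \<forall>z\<in>ref_square.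
        g (m, chart M m z) + g' (m, chart M m z) = (1 / det (jac M m z)) * f z" for m
    proof -
      obtain f where "f \<in> S_ref (degr M)"
        "\<forall>z\<in>ref_square. g (m, chart M m z) = (1 / det (jac M m z)) * f z"
        by (rule S_space_pullback[where m = m, OF g(1)])
      moreover obtain f' where "f' \<in> S_ref (degr M)"
        "\<forall>z\<in>ref_square. g' (m, chart M m z) = (1 / det (jac M m z)) * f' z"
        by (rule S_space_pullback[where m = m, OF g(2)])
      ultimately show ?thesis
        unfolding S_ref_def
        by (intro bexI[of _ "\<lambda>z. f z + f' z"] tensor_poly_add) (auto simp: add_divide_distrib)
    qed
    then show ?thesis
      using g unfolding S_space_def by simp
  qed
  show "(\<lambda>x. a *\<^sub>R g x) \<in> S_space M" if g: "g \<in> S_space M"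
  proof -
    have "\<exists>f\<in>S_ref (degr M). \<forall>z\<in>ref_square.
        a * g (m, chart M m z) = (1 / det (jac M m z)) * f z" for m
    proof -
      obtain f where "f \<in> S_ref (degr M)"
        "\<forall>z\<in>ref_square. g (m, chart M m z) = (1 / det (jac M m z)) * f z"
        by (rule S_space_pullback[where m = m, OF g])
      then show ?thesis
        unfolding S_ref_def by (intro bexI[of _ "\<lambda>z. a * f z"] tensor_poly_scale) auto
    qed
    then show ?thesis
      using g unfolding S_space_def by simp
  qed
qed

lemma expand_in_C_space: "(\<And>i. \<Psi> i \<in> C_space M) \<Longrightarrow> expand \<Psi> c \<in> C_space M"
  by (rule expand_in_space[OF C_space_closed(1)]) (assumption | rule C_space_closed)+

lemma expand_in_D_space: "(\<And>i. \<Psi> i \<in> D_space M) \<Longrightarrow> expand \<Psi> c \<in> D_space M"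
  by (rule expand_in_space[OF D_space_closed(1)]) (assumption | rule D_space_closed)+

lemma expand_in_S_space: "(\<And>i. \<Psi> i \<in> S_space M) \<Longrightarrow> expand \<Psi> c \<in> S_space M"
  by (rule expand_in_space[OF S_space_closed(1)]) (assumption | rule S_space_closed)+

lemma basis_for_dofs_in_space: "basis_for_dofs V dof \<Psi> \<Longrightarrow> \<Psi> i \<in> V"
  by (simp add: basis_for_dofs_def)

section \<open>Charts and their inverses, up to the boundary of the square\<close>

lemma Ck_on_2_D:
  fixes \<Phi> :: "'a::real_normed_vector \<Rightarrow> 'b::real_normed_vector"
  assumes "Ck_on 2 \<Phi> U" "open U" "z \<in> U"
  shows "(\<Phi> has_derivative frechet_derivative \<Phi> (at z)) (at z)"
    "(\<lambda>z. frechet_derivative \<Phi> (at z) v) differentiable (at z)"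
proof -
  have "\<Phi> differentiable_on U" "(\<lambda>z. frechet_derivative \<Phi> (at z) v) differentiable_on U"
    using assms(1) by (simp_all add: numeral_2_eq_2)
  then show "(\<Phi> has_derivative frechet_derivative \<Phi> (at z)) (at z)"
    "(\<lambda>z. frechet_derivative \<Phi> (at z) v) differentiable (at z)"
    using assms(2,3) frechet_derivative_works[of \<Phi> "at z"]
    by (simp_all add: differentiable_on_eq_differentiable_at)
qed

lemma chart_extension:
  assumes "meshed_domain M"
  obtains U g where "open U" "ref_square \<subseteq> U" "open (chart M m ` U)" "\<And>z. z \<in> U \<Longrightarrow> g (chart M m z) = z"
    "Ck_on 2 (chart M m) U" "Ck_on 2 g (chart M m ` U)"
proof -
  have "diffeomorphism_near ref_square (chart M m)"
    using assms by (simp add: meshed_domain_def)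
  then show ?thesis
    unfolding diffeomorphism_near_def using that by blast
qed

text \<open>\<open>jac\<close> uses the full filter \<open>at z\<close> even on the sides of the
  square; this is legitimate because the chart is of class C^2 on an open neighbourhood of the
  square.\<close>

lemma chart_has_derivative:
  assumes "meshed_domain M" "z \<in> ref_square"
  shows "(chart M m has_derivative (\<lambda>v. jac M m z *v v)) (at z)"
proof -
  obtain U g where U: "open U" "ref_square \<subseteq> U" "Ck_on 2 (chart M m) U"
    using chart_extension[OF assms(1)] by metis
  then have *: "(chart M m has_derivative frechet_derivative (chart M m) (at z)) (at z)"
    using Ck_on_2_D assms(2) by blast
  then have "frechet_derivative (chart M m) (at z) = (\<lambda>v. jac M m z *v v)"
    unfolding jac_def jacobian_def using has_derivative_linear matrix_works
    by (metis matrix_vector_mul_linear ext matrix_vector_mul)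
  then show ?thesis using * by simp
qed

lemma chart_continuous:
  assumes "meshed_domain M"
  shows "continuous_on ref_square (chart M m)"
  by (intro continuous_at_imp_continuous_on ballI has_derivative_continuous[OF chart_has_derivative[OF assms]])

lemma jac_continuous:
  assumes "meshed_domain M"
  shows "continuous_on ref_square (jac M m)"
proof -
  obtain U g where U: "open U" "ref_square \<subseteq> U" "Ck_on 2 (chart M m) U"
    using chart_extension[OF assms(1)] by metis
  have "isCont (\<lambda>z. frechet_derivative (chart M m) (at z) v) z" if "z \<in> ref_square" for v z
    by (rule differentiable_imp_continuous_within[OF Ck_on_2_D(2)[OF U(3,1) subsetD[OF U(2) that]]])
  then have "continuous_on ref_square (\<lambda>z. frechet_derivative (chart M m) (at z) v)" for v
    by (simp add: continuous_at_imp_continuous_on)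
  then have "continuous_on ref_square (\<lambda>z. \<chi> i j. frechet_derivative (chart M m) (at z) (axis j 1) $ i)"
    by (intro continuous_on_vec_lambda continuous_on_component)
  then show ?thesis
    by (simp add: jac_def jacobian_def matrix_def cong: continuous_on_cong)
qed

lemma continuous_on_matrix_vector_mult:
  fixes A :: "'a::topological_space \<Rightarrow> real^'n^'m"
  assumes "continuous_on S A" "continuous_on S u"
  shows "continuous_on S (\<lambda>z. A z *v u z)"
  unfolding matrix_vector_mult_def
  by (intro continuous_on_vec_lambda continuous_on_sum continuous_on_mult continuous_on_component assms)

lemma det_jac_pos: "meshed_domain M \<Longrightarrow> z \<in> ref_square \<Longrightarrow> 0 < det (jac M m z)"
  by (simp add: meshed_domain_def)

lemma inverse_det_jac_continuous:
  assumes "meshed_domain M"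
  shows "continuous_on ref_square (\<lambda>z. 1 / det (jac M m z))"
proof -
  have "continuous_on ref_square (\<lambda>z. det (jac M m z))"
    unfolding det_2 using jac_continuous[OF assms, of m]
    by (intro continuous_intros continuous_on_component)
  then show ?thesis
    using det_jac_pos[OF assms] by (intro continuous_intros) (auto simp: less_le)
qed

lemma D_space_pullback_continuous:
  assumes "meshed_domain M" "q \<in> D_space M"
  shows "continuous_on ref_square (\<lambda>z. q (m, chart M m z))"
proof -
  obtain u where u: "u \<in> D_ref (degr M)"
    "\<forall>z\<in>ref_square. q (m, chart M m z) = (1 / det (jac M m z)) *\<^sub>R (jac M m z *v u z)"
    by (rule D_space_pullback[where m = m, OF assms(2)])
  have "continuous_on ref_square (\<lambda>z. u z $ 1)" "continuous_on ref_square (\<lambda>z. u z $ 2)"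
    using u(1) unfolding D_ref_def by (blast intro: tensor_poly_continuous)+
  then have "continuous_on ref_square (\<lambda>z. u z $ k)" for k
    using exhaust_2[of k] by auto
  then have "continuous_on ref_square u"
    using continuous_on_vec_lambda[of ref_square "\<lambda>k z. u z $ k"] by simp
  then have "continuous_on ref_square (\<lambda>z. (1 / det (jac M m z)) *\<^sub>R (jac M m z *v u z))"
    by (intro continuous_on_scaleR continuous_on_matrix_vector_mult inverse_det_jac_continuous
        jac_continuous assms(1))
  then show ?thesis
    using u(2) by (simp cong: continuous_on_cong)
qed

lemma S_space_pullback_continuous:
  assumes "meshed_domain M" "g \<in> S_space M"
  shows "continuous_on ref_square (\<lambda>z. g (m, chart M m z))"
proof -
  obtain f where f: "f \<in> S_ref (degr M)"
    "\<forall>z\<in>ref_square. g (m, chart M m z) = (1 / det (jac M m z)) * f z"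
    by (rule S_space_pullback[where m = m, OF assms(2)])
  have "continuous_on ref_square (\<lambda>z. (1 / det (jac M m z)) * f z)"
    using f(1) unfolding S_ref_def
    by (intro continuous_on_mult inverse_det_jac_continuous tensor_poly_continuous assms(1))
  then show ?thesis
    using f(2) by (simp cong: continuous_on_cong)
qed

definition open_square :: "pt set" where
  "open_square = box (vector [-1, -1]) (vector [1, 1])"

lemma open_square:
  "open open_square" "closure open_square = ref_square" "open_square \<subseteq> ref_square"
proof -
  have "(0::pt) \<in> open_square"
    by (auto simp: open_square_def mem_box_cart forall_2)
  then show "closure open_square = ref_square"
    unfolding open_square_def ref_square_def by (metis closure_box empty_iff)
  then show "open_square \<subseteq> ref_square" using closure_subset by blast
  show "open open_square" unfolding open_square_def by (rule open_box)
qed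

text \<open>The image is the preimage of the open square under the continuous inverse chart on an
  open set, hence open. It is the dense part of the element on which derivatives are computed and
  the identities of \<open>discretization\<close> apply.\<close>

lemma chart_open_square:
  assumes "meshed_domain M"
  shows "open (chart M m ` open_square)" "chart M m ` open_square \<subseteq> interior (element M m)"
    "element M m \<subseteq> closure (chart M m ` open_square)"
proof -
  obtain U g where U: "open U" "ref_square \<subseteq> U" "open (chart M m ` U)"
    "\<And>z. z \<in> U \<Longrightarrow> g (chart M m z) = z" "Ck_on 2 g (chart M m ` U)"
    using chart_extension[OF assms(1)] by metis
  have "chart M m ` open_square = chart M m ` U \<inter> g -` open_square"
    using U(2,4) open_square(3) by force
  moreover have "continuous_on (chart M m ` U) g"
    by (intro continuous_at_imp_continuous_on ballI has_derivative_continuous[OF Ck_on_2_D(1)[OF U(5,3)]])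
  ultimately show op: "open (chart M m ` open_square)"
    using continuous_on_open_vimage[OF U(3)] open_square(1) by (metis Int_commute)
  then show "chart M m ` open_square \<subseteq> interior (element M m)"
    unfolding element_def by (intro interior_maximal image_mono open_square)
  show "element M m \<subseteq> closure (chart M m ` open_square)"
    unfolding element_def open_square(2)[symmetric]
    by (intro image_closure_subset) (auto simp: open_square(2) chart_continuous[OF assms] intro: closure_subset[THEN subsetD])
qed

lemma element_compact: "meshed_domain M \<Longrightarrow> compact (element M m)"
  unfolding element_def
  by (intro compact_continuous_image chart_continuous) (simp_all add: ref_square_def compact_cbox)

text \<open>Both directions are composition with a continuous map, the chart or its inverse.
  Continuity of fields given by formulas on the square is thus transported to the elements.\<close>

lemma continuous_on_element_iff:
  fixes h :: "pt \<Rightarrow> 'a::topological_space"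
  assumes "meshed_domain M"
  shows "continuous_on (element M m) h \<longleftrightarrow> continuous_on ref_square (\<lambda>z. h (chart M m z))"
proof
  assume "continuous_on (element M m) h"
  then show "continuous_on ref_square (\<lambda>z. h (chart M m z))"
    by (rule continuous_on_compose2) (auto simp: chart_continuous[OF assms] element_def)
next
  assume h: "continuous_on ref_square (\<lambda>z. h (chart M m z))"
  obtain U g where U: "open U" "ref_square \<subseteq> U" "open (chart M m ` U)"
    "\<And>z. z \<in> U \<Longrightarrow> g (chart M m z) = z" "Ck_on 2 g (chart M m ` U)"
    using chart_extension[OF assms(1)] by metis
  have "continuous_on (chart M m ` U) g"
    by (intro continuous_at_imp_continuous_on ballI has_derivative_continuous[OF Ck_on_2_D(1)[OF U(5,3)]])
  then have "continuous_on (element M m) g"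
    unfolding element_def by (rule continuous_on_subset) (use U in auto)
  moreover have "g ` element M m \<subseteq> ref_square"
    using U by (force simp: element_def)
  ultimately have "continuous_on (element M m) (\<lambda>x. h (chart M m (g x)))"
    by (rule continuous_on_compose2[OF h])
  then show "continuous_on (element M m) h"
    by (rule continuous_on_eq) (use U in \<open>auto simp: element_def subset_iff\<close>)
qed

section \<open>Mass matrices\<close>

lemma gll_in_interval:
  assumes "meshed_domain M" "i \<le> degr M"
  shows "-1 \<le> gll M i" "gll M i \<le> 1"
proof -
  have g: "gll M 0 = -1" "gll M (degr M) = 1" "strict_mono_on {0..degr M} (gll M)"
    using assms(1) by (simp_all add: meshed_domain_def gll_nodes_def)
  then have m: "mono_on {0..degr M} (gll M)"
    using strict_mono_on_imp_mono_on by blast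
  have "gll M 0 \<le> gll M i" "gll M i \<le> gll M (degr M)"
    using assms(2) by (auto intro!: mono_onD[OF m])
  then show "-1 \<le> gll M i" "gll M i \<le> 1" using g by simp_all
qed

lemma grid_point_in_ref_square:
  "meshed_domain M \<Longrightarrow> i \<le> degr M \<Longrightarrow> j \<le> degr M \<Longrightarrow> grid_point M i j \<in> ref_square"
  by (auto simp: ref_square_def grid_point_def mem_box_cart forall_2 gll_in_interval)

text \<open>The end points differ because the GLL nodes are strictly increasing; this later makes
  the tangent of the mapped edge nonzero.\<close>

lemma ref_edges_D:
  assumes "meshed_domain M" "(a, b) \<in> ref_edges M"
  shows "a \<in> ref_square" "b \<in> ref_square" "a \<noteq> b"
    "chart M m a \<in> mesh_nodes M" "chart M m b \<in> mesh_nodes M"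
proof -
  have less: "gll M i < gll M (Suc i)" if "i < degr M" for i
    using assms(1) that unfolding meshed_domain_def gll_nodes_def
    by (auto intro: strict_mono_onD[of "{0..degr M}"])
  obtain i j i' j' where ij: "a = grid_point M i j" "b = grid_point M i' j'"
    "i \<le> degr M" "j \<le> degr M" "i' \<le> degr M" "j' \<le> degr M"
    "gll M i \<noteq> gll M i' \<or> gll M j \<noteq> gll M j'"
    using assms(2) less unfolding ref_edges_def by fastforce
  then show "a \<in> ref_square" "b \<in> ref_square"
    by (simp_all add: grid_point_in_ref_square[OF assms(1)])
  show "a \<noteq> b"
    using ij(1,2,7) by (auto simp: grid_point_def vec_eq_iff forall_2)
  show "chart M m a \<in> mesh_nodes M" "chart M m b \<in> mesh_nodes M"
    using ij unfolding mesh_nodes_def by blast+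
qed

lemma linepath_in_ref_square:
  assumes "a \<in> ref_square" "b \<in> ref_square" "t \<in> {0..1}"
  shows "linepath a b t \<in> ref_square"
proof -
  have "convex ref_square" by (simp add: ref_square_def convex_box)
  then show ?thesis
    using assms closed_segment_subset linepath_in_path by blast
qed

lemma edge_path_has_vector_derivative:
  assumes "meshed_domain M" "a \<in> ref_square" "b \<in> ref_square" "t \<in> {0..1}"
  shows "(chart M m \<circ> linepath a b has_vector_derivative jac M m (linepath a b t) *v (b - a)) (at t)"
proof -
  have "(linepath a b has_derivative (\<lambda>h. h *\<^sub>R (b - a))) (at t)"
    using has_vector_derivative_linepath_within[of a b t UNIV] by (simp add: has_vector_derivative_def)
  from diff_chain_at[OF this chart_has_derivative[OF assms(1) linepath_in_ref_square[OF assms(2-4)]]]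
  show ?thesis
    by (simp add: has_vector_derivative_def o_def matrix_vector_mult_scaleR)
qed

text \<open>With \<open>v = b - a\<close> this says that edge parametrizations are regular, so that
  one may divide by their speed.\<close>

lemma jac_mult_nonzero:
  assumes "meshed_domain M" "z \<in> ref_square" "v \<noteq> 0"
  shows "jac M m z *v v \<noteq> 0"
  using det_jac_pos[OF assms(1,2), of m] assms(3) invertible_det_nz[of "jac M m z"]
    invertible_left_inverse matrix_left_invertible_ker by (metis less_irrefl)

lemma edge_tangent_continuous:
  assumes "meshed_domain M" "a \<in> ref_square" "b \<in> ref_square"
  shows "continuous_on {0..1} (\<lambda>t. jac M m (linepath a b t) *v (b - a))"
  by (intro continuous_on_matrix_vector_mult continuous_on_compose2[OF jac_continuous[OF assms(1)]]
      continuous_on_linepath continuous_on_const) (use linepath_in_ref_square assms in blast)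

text \<open>The representation picked by SOME depends on the edge alone, so a single choice serves
  all integrands \<open>g\<close>. This is what makes \<open>edge_integral\<close> linear.\<close>

lemma edge_integral_chosen_path:
  assumes "E \<in> mesh_edges M"
  obtains m a b where "(a, b) \<in> ref_edges M" "path_image (chart M m \<circ> linepath a b) = E"
    "\<And>g. edge_integral M E g = integral {0..1}
      (\<lambda>t. g (m, (chart M m \<circ> linepath a b) t) * norm (vector_derivative (chart M m \<circ> linepath a b) (at t)))"
proof -
  have "edge_paths M E \<noteq> {}"
    using assms unfolding edge_paths_def mesh_edges_def by blast
  then have "(SOME p. p \<in> edge_paths M E) \<in> edge_paths M E"
    by (simp add: some_in_eq)
  then obtain m a b where "(SOME p. p \<in> edge_paths M E) = (m, chart M m \<circ> linepath a b)"
    "(a, b) \<in> ref_edges M" "path_image (chart M m \<circ> linepath a b) = E"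
    unfolding edge_paths_def by blast
  then show ?thesis
    by (intro that) (simp_all add: edge_integral_def)
qed

lemma quadratic_form_of_kernel:
  fixes A :: "real^'n^'n"
  assumes "A *v c = 0"
  shows "(\<Sum>i\<in>UNIV. \<Sum>j\<in>UNIV. c $ i * c $ j * A $ i $ j) = 0"
proof -
  have "(\<Sum>i\<in>UNIV. \<Sum>j\<in>UNIV. c $ i * c $ j * A $ i $ j) = c \<bullet> (A *v c)"
    by (simp add: inner_vec_def matrix_vector_mult_def sum_distrib_left mult_ac)
  then show ?thesis using assms by simp
qed

lemma D_space_continuous:
  assumes "meshed_domain M" "q \<in> D_space M"
  shows "continuous_on (element M m) (\<lambda>x. q (m, x))"
  using D_space_pullback_continuous[OF assms] by (simp add: continuous_on_element_iff[OF assms(1)])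

lemma integral_element_eq_0_imp_zero:
  assumes "meshed_domain M" "continuous_on (element M m) f" "\<And>x. x \<in> element M m \<Longrightarrow> 0 \<le> f x"
    "integral (element M m) f = 0" "x \<in> element M m"
  shows "f x = (0::real)"
  using integral_eq_0_imp_zero[OF element_compact[OF assms(1)] assms(2,3) chart_open_square(1)[OF assms(1)]
      _ chart_open_square(3)[OF assms(1)] assms(4,5)] chart_open_square(2)[OF assms(1)] interior_subset by blast

text \<open>Gram matrix argument: the quadratic form at \<open>c\<close> is the sum over the
  elements of the integrals of \<open>q \<bullet> q\<close> for the expanded field \<open>q\<close>.
  Each of them must vanish, so \<open>q\<close> is zero, and the basis is independent.\<close>

lemma mass1_injective:
  assumes M: "meshed_domain M" and \<Psi>: "basis_for_dofs (D_space M) (dof1 M) (Psi1 M)"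
    and c: "mass1 M *v c = 0"
  shows "c = 0"
proof -
  define q where "q = expand (Psi1 M) c"
  note \<Psi>D = basis_for_dofs_in_space[OF \<Psi>]
  have qD: "q \<in> D_space M"
    unfolding q_def by (rule expand_in_D_space[OF \<Psi>D])
  have int: "(\<lambda>x. Psi1 M i (m, x) \<bullet> Psi1 M j (m, x)) integrable_on element M m" for i j m
    by (intro integrable_on_compact element_compact continuous_on_inner D_space_continuous M \<Psi>D)
  have "q p \<bullet> q p = (\<Sum>i\<in>UNIV. \<Sum>j\<in>UNIV. c $ i * c $ j * (Psi1 M i p \<bullet> Psi1 M j p))" for p
    by (simp add: q_def expand_def inner_sum_left inner_sum_right sum_distrib_left mult_ac inner_commute)
  then have "(\<Sum>m\<in>UNIV. integral (element M m) (\<lambda>x. q (m, x) \<bullet> q (m, x))) =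
    (\<Sum>m\<in>UNIV. \<Sum>i\<in>UNIV. \<Sum>j\<in>UNIV. c $ i * c $ j * integral (element M m) (\<lambda>x. Psi1 M i (m, x) \<bullet> Psi1 M j (m, x)))"
    by (simp add: integral_sum int integrable_sum integrable_on_mult_right)
  also have "\<dots> = (\<Sum>i\<in>UNIV. \<Sum>j\<in>UNIV. c $ i * c $ j *
      (\<Sum>m\<in>UNIV. integral (element M m) (\<lambda>x. Psi1 M i (m, x) \<bullet> Psi1 M j (m, x))))"
    unfolding sum_distrib_left
    by (subst sum.swap, intro sum.cong refl, subst sum.swap, rule refl)
  also have "\<dots> = 0"
    using quadratic_form_of_kernel[OF c] by (simp add: mass1_def piecewise_mass_def)
  finally have "(\<Sum>m\<in>UNIV. integral (element M m) (\<lambda>x. q (m, x) \<bullet> q (m, x))) = 0" .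
  moreover have cont: "continuous_on (element M m) (\<lambda>x. q (m, x) \<bullet> q (m, x))" for m
    by (intro continuous_on_inner D_space_continuous M qD)
  moreover have "0 \<le> integral (element M m) (\<lambda>x. q (m, x) \<bullet> q (m, x))" for m
    by (intro integral_nonneg integrable_on_compact element_compact M cont) auto
  ultimately have "integral (element M m) (\<lambda>x. q (m, x) \<bullet> q (m, x)) = 0" for m
    by (simp add: sum_nonneg_eq_0_iff)
  then have "q (m, x) \<bullet> q (m, x) = 0" if "x \<in> element M m" for m x
    by (intro integral_element_eq_0_imp_zero[OF M cont _ _ that]) simp_all
  \<comment> \<open>Off the element the extension by zero applies, so that \<open>q\<close> vanishes
    as a function.\<close>
  moreover have "q (m, x) = 0" if "x \<notin> element M m" for m x
    using qD that by (simp add: D_space_def)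
  ultimately have "q = (\<lambda>p. 0)"
    by (intro ext) (metis inner_eq_zero_iff surj_pair)
  then show ?thesis
    using \<Psi> unfolding q_def basis_for_dofs_def by blast
qed

section \<open>Arc-length integrals on the boundary and the nodal boundary mass matrix\<close>

lemma edge_in_mesh_edges: "meshed_domain M \<Longrightarrow> edge M e \<in> mesh_edges M"
  unfolding meshed_domain_def bij_betw_def by auto

lemma bedge_frontier: "meshed_domain M \<Longrightarrow> edge M (bedge M b) \<subseteq> frontier (region M)"
  unfolding meshed_domain_def bij_betw_def by auto

lemma bnode_frontier: "meshed_domain M \<Longrightarrow> node M (bnode M b) \<in> frontier (region M)"
  unfolding meshed_domain_def bij_betw_def by auto

lemma frontier_covered_by_bedges:
  assumes M: "meshed_domain M" and x: "x \<in> frontier (region M)"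
  obtains b where "x \<in> edge M (bedge M b)"
proof -
  have "frontier (region M) = \<Union>{E \<in> mesh_edges M. E \<subseteq> frontier (region M)}"
    using M by (simp add: meshed_domain_def)
  then obtain E where E: "x \<in> E" "E \<in> mesh_edges M" "E \<subseteq> frontier (region M)"
    using x by blast
  have "range (edge M) = mesh_edges M" "range (bedge M) = {e. edge M e \<subseteq> frontier (region M)}"
    using M by (simp_all add: meshed_domain_def bij_betw_def)
  moreover from this(1) obtain e where "E = edge M e"
    using E(2) by auto
  ultimately obtain b where "E = edge M (bedge M b)"
    using E(3) by (metis (mono_tags) mem_Collect_eq rangeE)
  then show ?thesis using E(1) that by blast
qed

lemma bd_integrand_continuous:
  assumes M: "meshed_domain M" and ab: "(a, b) \<in> ref_edges M"
    and E: "path_image (chart M m \<circ> linepath a b) = E" and h: "continuous_on E h"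
  shows "continuous_on {0..1} (\<lambda>t. h ((chart M m \<circ> linepath a b) t) *
    norm (vector_derivative (chart M m \<circ> linepath a b) (at t)) :: real)"
proof -
  note [simp] = ref_edges_D(1-3)[OF M ab]
  note vd = edge_path_has_vector_derivative[OF M ref_edges_D(1,2)[OF M ab], where m = m]
  have vd': "vector_derivative (chart M m \<circ> linepath a b) (at t) = jac M m (linepath a b t) *v (b - a)"
    if "t \<in> {0..1}" for t
    using vd[OF that] by (rule vector_derivative_at)
  have "continuous_on {0..1} (chart M m \<circ> linepath a b)"
    by (intro continuous_at_imp_continuous_on ballI has_vector_derivative_continuous[OF vd])
  then have "continuous_on {0..1} (\<lambda>t. h ((chart M m \<circ> linepath a b) t))"
    by (rule continuous_on_compose2[OF h]) (use E in \<open>auto simp: path_image_def\<close>)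
  then have "continuous_on {0..1} (\<lambda>t. h ((chart M m \<circ> linepath a b) t) * norm (jac M m (linepath a b t) *v (b - a)))"
    by (intro continuous_on_mult continuous_on_norm edge_tangent_continuous M) auto
  then show ?thesis
    by (rule continuous_on_eq) (simp add: vd')
qed

text \<open>In the second claim the integrand \<open>h\<close> times speed vanishes at every
  parameter, and the speed is nonzero because the parametrization is regular.\<close>

lemma edge_integral_nonneg:
  assumes M: "meshed_domain M" and E: "E \<in> mesh_edges M" and h: "continuous_on E h" "\<And>x. x \<in> E \<Longrightarrow> 0 \<le> h x"
  shows "0 \<le> edge_integral M E (\<lambda>(m, x). h x)"
    and "edge_integral M E (\<lambda>(m, x). h x) = 0 \<Longrightarrow> x \<in> E \<Longrightarrow> h x = 0"
proof -
  obtain m a b where ab: "(a, b) \<in> ref_edges M" and im: "path_image (chart M m \<circ> linepath a b) = E"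
    and ei: "\<And>g. edge_integral M E g = integral {0..1}
      (\<lambda>t. g (m, (chart M m \<circ> linepath a b) t) * norm (vector_derivative (chart M m \<circ> linepath a b) (at t)))"
    by (rule edge_integral_chosen_path[OF E]) (rule that)
  let ?\<gamma> = "chart M m \<circ> linepath a b"
  let ?f = "\<lambda>t. h (?\<gamma> t) * norm (vector_derivative ?\<gamma> (at t))"
  have cont: "continuous_on {0..1} ?f"
    by (rule bd_integrand_continuous[OF M ab im h(1)])
  then have int: "?f integrable_on {0..1}"
    by (rule integrable_continuous_interval)
  have \<gamma>E: "?\<gamma> t \<in> E" if "t \<in> {0..1}" for t
    using im that by (force simp: path_image_def)
  have nn: "0 \<le> ?f t" if "t \<in> {0..1}" for t
    using h(2)[OF \<gamma>E[OF that]] by simp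
  then show "0 \<le> edge_integral M E (\<lambda>(m, x). h x)"
    unfolding ei prod.case by (rule integral_nonneg[OF int])
  show "h x = 0" if 0: "edge_integral M E (\<lambda>(m, x). h x) = 0" and x: "x \<in> E"
  proof -
    obtain t where t: "t \<in> {0..1}" "x = ?\<gamma> t"
      using x unfolding im[symmetric] path_image_def by (rule imageE)
    have "integral {0..1} ?f = 0" using 0 unfolding ei by simp
    then have "(?f has_integral 0) (cbox 0 1)"
      using integrable_integral[OF int] by simp
    moreover have "continuous_on (cbox 0 1) ?f" "t \<in> cbox 0 1"
      using cont t(1) by simp_all
    moreover have "0 \<le> ?f s" if "s \<in> box 0 1" for s
      using that by (intro nn) auto
    ultimately have "?f t = 0"
      by (intro has_integral_0_cbox_imp_0[of 0 1 ?f t]) auto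
    moreover have "vector_derivative ?\<gamma> (at t) \<noteq> 0"
      using vector_derivative_at[OF edge_path_has_vector_derivative[OF M ref_edges_D(1,2)[OF M ab] t(1)]]
        jac_mult_nonzero[OF M linepath_in_ref_square[OF ref_edges_D(1,2)[OF M ab] t(1)]] ref_edges_D(3)[OF M ab]
      by (metis right_minus_eq)
    ultimately show ?thesis using t(2) by simp
  qed
qed

lemma edge_integral_sum:
  assumes M: "meshed_domain M" and E: "E \<in> mesh_edges M" and h: "\<And>i. i \<in> I \<Longrightarrow> continuous_on E (h i)" and "finite I"
  shows "edge_integral M E (\<lambda>(m, x). \<Sum>i\<in>I. c i * h i x) = (\<Sum>i\<in>I. c i * edge_integral M E (\<lambda>(m, x). h i x))"
proof -
  obtain m a b where ab: "(a, b) \<in> ref_edges M" and im: "path_image (chart M m \<circ> linepath a b) = E"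
    and ei: "\<And>g. edge_integral M E g = integral {0..1}
      (\<lambda>t. g (m, (chart M m \<circ> linepath a b) t) * norm (vector_derivative (chart M m \<circ> linepath a b) (at t)))"
    by (rule edge_integral_chosen_path[OF E]) (rule that)
  have int: "(\<lambda>t. h i ((chart M m \<circ> linepath a b) t) *
    norm (vector_derivative (chart M m \<circ> linepath a b) (at t))) integrable_on {0..1}" if "i \<in> I" for i
    by (intro integrable_continuous_interval bd_integrand_continuous[OF M ab im] h that)
  show ?thesis
    unfolding ei using int \<open>finite I\<close>
    by (simp add: sum_distrib_right mult.assoc integral_sum integrable_on_mult_right del: o_apply)
qed

lemma dof0_expand_nth:
  assumes "basis_for_dofs (C_space M) (dof0 M) (Psi0 M)"
  shows "expand (Psi0 M) c (node M i) = c $ i"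
proof -
  have "expand (Psi0 M) c \<in> C_space M"
    by (rule expand_in_C_space[OF basis_for_dofs_in_space[OF assms]])
  from dof_expand[OF assms this] show ?thesis
    by (metis dof0_def vec_lambda_beta)
qed

lemma incl0_mult_bnode:
  assumes "meshed_domain M"
  shows "(incl0 M *v c) $ bnode M b = c $ b"
proof -
  have "bnode M b = bnode M j \<longleftrightarrow> b = j" for j
    using assms unfolding meshed_domain_def bij_betw_def inj_def by auto
  then show ?thesis
    by (simp add: incl0_def matrix_vector_mult_def if_distrib[of "\<lambda>x. x * _"] cong: if_cong)
qed

lemma expand_Psi_b0: "expand (Psi_b0 M) c = trace M (expand (Psi0 M) (incl0 M *v c))"
  unfolding Psi_b0_def expand_row_mult by (rule ext) (simp add: expand_def trace_def)

text \<open>Evaluation at a boundary node reads off the corresponding coefficient, since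
  \<open>Psi0\<close> is a nodal basis.\<close>

lemma Psi_b0_independent:
  assumes "meshed_domain M" "basis_for_dofs (C_space M) (dof0 M) (Psi0 M)"
    and "\<And>x. x \<in> frontier (region M) \<Longrightarrow> expand (Psi_b0 M) c x = 0"
  shows "c = 0"
proof -
  have "c $ b = 0" for b
    using assms(3)[OF bnode_frontier[OF assms(1), of b]] bnode_frontier[OF assms(1), of b]
    by (simp add: expand_Psi_b0 trace_def dof0_expand_nth[OF assms(2)] incl0_mult_bnode[OF assms(1)])
  then show ?thesis by (simp add: vec_eq_iff)
qed

text \<open>Gram matrix argument on the boundary: the expansion has vanishing square integral on
  each boundary edge, and these edges cover the frontier.\<close>

lemma boundary_mass0_injective:
  fixes c :: "real^'bn"
  assumes M: "meshed_domain M" and \<Psi>: "basis_for_dofs (C_space M) (dof0 M) (Psi0 M)"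
    and c: "boundary_mass M (Psi_b0 M) *v c = 0"
  shows "c = 0"
proof -
  define f where "f = expand (Psi_b0 M) c"
  have cont: "continuous_on (edge M (bedge M b)) (expand (Psi_b0 M) d)" for b d
  proof -
    have "expand (Psi0 M) (incl0 M *v d) \<in> C_space M"
      by (rule expand_in_C_space[OF basis_for_dofs_in_space[OF \<Psi>]])
    then have "continuous_on (closure (region M)) (expand (Psi0 M) (incl0 M *v d))"
      by (simp add: C_space_def)
    then have "continuous_on (edge M (bedge M b)) (expand (Psi0 M) (incl0 M *v d))"
      by (rule continuous_on_subset) (use bedge_frontier[OF M, of b] in \<open>auto simp: frontier_def\<close>)
    then show ?thesis
      by (rule continuous_on_eq) (use bedge_frontier[OF M, of b] in \<open>auto simp: expand_Psi_b0 trace_def\<close>)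
  qed
  have cont_basis: "continuous_on (edge M (bedge M b)) (Psi_b0 M i)" for b i
    using cont[of b "axis i 1"] by (simp add: expand_axis)
  \<comment> \<open>Double sums are read as sums over pairs, because
    \<open>edge_integral_sum\<close> takes a single finite index set.\<close>
  have pair: "(\<Sum>(i, j)\<in>UNIV. G i j) = (\<Sum>i\<in>UNIV. \<Sum>j\<in>UNIV. G i j)" for G :: "'bn \<Rightarrow> 'bn \<Rightarrow> real"
    by (simp add: sum.cartesian_product flip: UNIV_Times_UNIV)
  have sq: "f x * f x = (\<Sum>(i, j)\<in>UNIV. c $ i * c $ j * (Psi_b0 M i x * Psi_b0 M j x))" for x
    by (simp add: f_def expand_def sum_product sum.cartesian_product mult_ac flip: UNIV_Times_UNIV)
  have "(\<Sum>b\<in>UNIV. edge_integral M (edge M (bedge M b)) (\<lambda>(m, x). f x * f x)) =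
    (\<Sum>b\<in>UNIV. \<Sum>(i, j)\<in>UNIV. c $ i * c $ j *
      edge_integral M (edge M (bedge M b)) (\<lambda>(m, x). Psi_b0 M i x * Psi_b0 M j x))"
    unfolding sq case_prod_unfold
    by (intro sum.cong refl edge_integral_sum[OF M, unfolded case_prod_unfold] edge_in_mesh_edges[OF M]
        continuous_on_mult cont_basis) simp
  also have "\<dots> = (\<Sum>(i, j)\<in>UNIV. \<Sum>b\<in>UNIV. c $ i * c $ j *
      edge_integral M (edge M (bedge M b)) (\<lambda>(m, x). Psi_b0 M i x * Psi_b0 M j x))"
    by (subst sum.swap) (simp add: case_prod_unfold)
  also have "\<dots> = (\<Sum>i\<in>UNIV. \<Sum>j\<in>UNIV. c $ i * c $ j * boundary_integral M (\<lambda>x. Psi_b0 M i x * Psi_b0 M j x))"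
    by (simp only: pair boundary_integral_def sum_distrib_left)
  also have "\<dots> = 0"
    using quadratic_form_of_kernel[OF c] by (simp add: boundary_mass_def)
  finally have s0: "(\<Sum>b\<in>UNIV. edge_integral M (edge M (bedge M b)) (\<lambda>(m, x). f x * f x)) = 0" .
  have fc: "continuous_on (edge M (bedge M b)) (\<lambda>x. f x * f x)" for b
    unfolding f_def by (intro continuous_on_mult cont)
  have e0: "edge_integral M (edge M (bedge M b)) (\<lambda>(m, x). f x * f x) = 0" for b
    using s0 edge_integral_nonneg(1)[OF M edge_in_mesh_edges[OF M] fc]
    by (simp add: sum_nonneg_eq_0_iff)
  have "f x = 0" if x: "x \<in> frontier (region M)" for x
  proof -
    obtain b where "x \<in> edge M (bedge M b)"
      using frontier_covered_by_bedges[OF M x] .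
    then have "f x * f x = 0"
      using edge_integral_nonneg(2)[OF M edge_in_mesh_edges[OF M] fc _ e0] by simp
    then show ?thesis by simp
  qed
  then show ?thesis
    using Psi_b0_independent[OF M \<Psi>] unfolding f_def by blast
qed

text \<open>This is the uniqueness behind THE in \<open>bd_coeff1\<close>. Two vectors with equal
  expansions have equal images under the inverse boundary mass matrix, which is undone by
  multiplication with that matrix.\<close>

lemma dual_Psi_b1_independent:
  assumes M: "meshed_domain M" and \<Psi>: "basis_for_dofs (C_space M) (dof0 M) (Psi0 M)"
    and "expand (dual_Psi_b1 M) c = expand (dual_Psi_b1 M) d"
  shows "c = d"
proof -
  let ?B = "boundary_mass M (Psi_b0 M)"
  have "expand (dual_Psi_b1 M) (c - d) = (\<lambda>x. 0)"
    using assms(3) by (simp add: expand_diff)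
  then have "matrix_inv ?B *v (c - d) = 0"
    using Psi_b0_independent[OF M \<Psi>] unfolding dual_Psi_b1_def expand_row_mult by metis
  then have "?B *v (matrix_inv ?B *v (c - d)) = 0" by simp
  then show "c = d"
    using matrix_inv_of_injective[OF boundary_mass0_injective[OF M \<Psi>]] by simp
qed

section \<open>Incidence matrices\<close>

lemma linear_apply_axes:
  fixes L :: "real^'n \<Rightarrow> real"
  assumes "linear L"
  shows "L w = (\<Sum>k\<in>UNIV. w $ k * L (axis k 1))"
proof -
  have "L w = L (\<Sum>k\<in>UNIV. w $ k *\<^sub>R axis k 1)"
    using basis_expansion[of w] by (simp add: scalar_mult_eq_scaleR)
  then show ?thesis
    by (simp add: linear_sum[OF assms] linear_scale[OF assms])
qed

text \<open>On the image of the open square, \<open>\<omega>\<close> is a polynomial composed with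
  the inverse chart, which is of class C^2.\<close>

lemma C_space_smooth:
  assumes M: "meshed_domain M" and \<omega>: "\<omega> \<in> C_space M"
  obtains D where "\<And>x. x \<in> chart M m ` open_square \<Longrightarrow> (\<omega> has_derivative D x) (at x)"
    "\<And>x v. x \<in> chart M m ` open_square \<Longrightarrow> (\<lambda>x. D x v) differentiable (at x)"
proof -
  let ?V = "chart M m ` open_square"
  obtain f where f: "f \<in> C_ref (degr M)" "\<forall>z\<in>ref_square. \<omega> (chart M m z) = f z"
    by (rule C_space_pullback[where m = m, OF \<omega>])
  obtain f' where f': "\<And>z. (f has_derivative f' z) (at z)" "\<And>v z. (\<lambda>z. f' z v) differentiable (at z)"
    by (rule tensor_poly_smooth[OF f(1)[unfolded C_ref_def]]) (rule that)
  obtain U g where U: "open U" "ref_square \<subseteq> U" "open (chart M m ` U)"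
    "\<And>z. z \<in> U \<Longrightarrow> g (chart M m z) = z" "Ck_on 2 g (chart M m ` U)"
    using chart_extension[OF M] by metis
  have VU: "x \<in> chart M m ` U" if "x \<in> ?V" for x
    using that open_square(3) U(2) by blast
  define Dg where "Dg x = frechet_derivative g (at x)" for x
  have Dg: "(g has_derivative Dg x) (at x)" "(\<lambda>x. Dg x v) differentiable (at x)" if "x \<in> ?V" for x v
    unfolding Dg_def by (rule Ck_on_2_D[OF U(5,3) VU[OF that]])+
  define D where "D x v = f' (g x) (Dg x v)" for x v
  show ?thesis
  proof (rule that)
    fix x assume x: "x \<in> ?V"
    have "((\<lambda>y. f (g y)) has_derivative D x) (at x)"
      unfolding D_def by (rule has_derivative_compose[OF Dg(1)[OF x] f'(1)])
    then show "(\<omega> has_derivative D x) (at x)"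
    proof (rule has_derivative_transform_within_open)
      show "f (g y) = \<omega> y" if "y \<in> ?V" for y
        using that f(2) U(2,4) open_square(3) by (auto dest!: subsetD)
    qed (use x chart_open_square(1)[OF M] in auto)
  next
    fix x v assume x: "x \<in> ?V"
    \<comment> \<open>\<open>f'\<close> is known to be differentiable only for a fixed direction,
      but here the direction \<open>Dg y v\<close> moves with \<open>y\<close>. Expanding along the
      axes leaves products of differentiable scalar functions.\<close>
    have eq: "D y v = (\<Sum>k\<in>UNIV. Dg y v $ k * f' (g y) (axis k 1))" for y
      unfolding D_def by (rule linear_apply_axes[OF has_derivative_linear[OF f'(1)]])
    have "(\<lambda>y. Dg y v $ k) differentiable (at x)" for k
      using Dg(2)[OF x, of v] bounded_linear_imp_differentiable[OF bounded_linear_vec_nth]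
      by (rule differentiable_compose[rotated])
    moreover have "(\<lambda>y. f' (g y) (axis k 1)) differentiable (at x)" for k
      by (rule differentiable_compose[OF f'(2)]) (use Dg(1)[OF x] differentiable_def in blast)
    ultimately show "(\<lambda>y. D y v) differentiable (at x)"
      unfolding eq by (intro differentiable_sum differentiable_mult ballI) auto
  qed
qed

lemma vector_2_eq_axes: "(vector [a, b] :: real^2) = a *\<^sub>R axis 1 1 + b *\<^sub>R axis 2 1"
  by (simp add: vec_eq_iff forall_2 axis_def)

text \<open>The divergence is the difference of the two mixed second derivatives. Agreement with the
  curl is asked only on \<open>V\<close>, since \<open>u\<close> will be the restriction of a
  piecewise field to one element.\<close>

lemma divergence_curl_eq_0:
  assumes V: "open V" "x \<in> V"
    and D: "\<And>y. y \<in> V \<Longrightarrow> (\<omega> has_derivative D y) (at y)" "\<And>v. (\<lambda>y. D y v) differentiable (at x)"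
    and u: "\<And>y. y \<in> V \<Longrightarrow> u y = curl \<omega> y"
  shows "divergence u x = 0"
proof -
  obtain A where A: "((\<lambda>y. D y (axis 2 1)) has_derivative A) (at x)"
    using D(2) differentiable_def by blast
  obtain B where B: "((\<lambda>y. D y (axis 1 1)) has_derivative B) (at x)"
    using D(2) differentiable_def by blast
  have "((\<lambda>y. D y (axis 2 1) *\<^sub>R axis 1 1 + (- D y (axis 1 1)) *\<^sub>R axis 2 1 :: pt) has_derivative
      (\<lambda>h. A h *\<^sub>R axis 1 1 + (- B h) *\<^sub>R axis 2 1)) (at x)"
    by (intro has_derivative_add has_derivative_scaleR_left has_derivative_minus A B)
  then have "(u has_derivative (\<lambda>h. A h *\<^sub>R axis 1 1 + (- B h) *\<^sub>R axis 2 1)) (at x)"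
  proof (rule has_derivative_transform_within_open[OF _ V])
    show "D y (axis 2 1) *\<^sub>R axis 1 1 + (- D y (axis 1 1)) *\<^sub>R axis 2 1 = u y" if "y \<in> V" for y
      using u[OF that] frechet_derivative_at[OF D(1)[OF that]] by (simp add: curl_def vector_2_eq_axes)
  qed
  then have "divergence u x = A (axis 1 1) - B (axis 2 1)"
    by (simp add: divergence_def frechet_derivative_at[symmetric] UNIV_2 axis_def)
  then show ?thesis
    using second_derivative_symmetric[OF V D(1) A B] by simp
qed

text \<open>The divergence is prescribed only inside the elements; continuity of the pullback
  carries its vanishing to the sides of the square.\<close>

lemma S_space_eq_0:
  assumes M: "meshed_domain M" and g: "g \<in> S_space M"
    and 0: "\<And>m x. x \<in> chart M m ` open_square \<Longrightarrow> g (m, x) = 0"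
  shows "g = (\<lambda>p. 0)"
proof -
  have "g (m, x) = 0" for m x
  proof (cases "x \<in> element M m")
    case True
    then obtain z where z: "z \<in> ref_square" "x = chart M m z"
      by (auto simp: element_def)
    have "g (m, chart M m z) = 0"
      by (rule continuous_constant_on_closure[of open_square "\<lambda>z. g (m, chart M m z)"])
        (simp_all add: open_square(2) S_space_pullback_continuous[OF M g] 0 z)
    then show ?thesis by (simp add: z)
  qed (use g in \<open>simp add: S_space_def\<close>)
  then show ?thesis by auto
qed

lemma discretization_D:
  assumes "discretization M"
  shows "meshed_domain M" "basis_for_dofs (C_space M) (dof0 M) (Psi0 M)"
    "basis_for_dofs (D_space M) (dof1 M) (Psi1 M)" "basis_for_dofs (S_space M) (dof2 M) (Psi2 M)"
    "\<omega> \<in> C_space M \<Longrightarrow> x \<in> interior (element M m) \<Longrightarrow>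
       curl \<omega> x = expand (Psi1 M) (E10 M *v dof0 M \<omega>) (m, x)"
    "q \<in> D_space M \<Longrightarrow> x \<in> interior (element M m) \<Longrightarrow>
       divergence (\<lambda>y. q (m, y)) x = expand (Psi2 M) (E21 M *v dof1 M q) (m, x)"
  using assms unfolding discretization_def by simp_all

text \<open>For any \<open>c\<close>, the field \<open>q\<close> is the curl of
  \<open>\<omega>\<close> inside each element and has degrees of freedom \<open>E10 M *v c\<close>.
  Its divergence is zero and has coefficients \<open>E21 M *v (E10 M *v c)\<close>, which vanish by
  independence of \<open>Psi2\<close>.\<close>

lemma E21_E10_eq_0:
  assumes dM: "discretization M"
  shows "E21 M ** E10 M = 0"
proof -
  note M = discretization_D(1)[OF dM] and B = discretization_D(2-4)[OF dM]
  have "E21 M *v (E10 M *v c) = 0" for c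
  proof -
    define \<omega> where "\<omega> = expand (Psi0 M) c"
    have \<omega>: "\<omega> \<in> C_space M"
      unfolding \<omega>_def by (rule expand_in_C_space[OF basis_for_dofs_in_space[OF B(1)]])
    have c: "dof0 M \<omega> = c"
      using dof_expand[OF B(1)] \<omega> unfolding \<omega>_def by blast
    define q where "q = expand (Psi1 M) (E10 M *v c)"
    have q: "q \<in> D_space M"
      unfolding q_def by (rule expand_in_D_space[OF basis_for_dofs_in_space[OF B(2)]])
    have dq: "dof1 M q = E10 M *v c"
      using dof_expand[OF B(2)] q unfolding q_def by blast
    have "expand (Psi2 M) (E21 M *v (E10 M *v c)) (m, x) = 0" if x: "x \<in> chart M m ` open_square" for m x
    proof -
      note V = chart_open_square(1,2)[OF M, of m]
      obtain D where "\<And>x. x \<in> chart M m ` open_square \<Longrightarrow> (\<omega> has_derivative D x) (at x)"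
        "\<And>x v. x \<in> chart M m ` open_square \<Longrightarrow> (\<lambda>x. D x v) differentiable (at x)"
        by (rule C_space_smooth[OF M \<omega>, of m]) (rule that)
      moreover have "q (m, y) = curl \<omega> y" if "y \<in> chart M m ` open_square" for y
        using discretization_D(5)[OF dM \<omega> subsetD[OF V(2) that]] by (simp add: q_def c)
      ultimately have "divergence (\<lambda>y. q (m, y)) x = 0"
        using divergence_curl_eq_0[OF V(1) x, of \<omega> D "\<lambda>y. q (m, y)"] x by blast
      then show ?thesis
        using discretization_D(6)[OF dM q subsetD[OF V(2) x]] by (simp add: dq)
    qed
    moreover have "expand (Psi2 M) (E21 M *v (E10 M *v c)) \<in> S_space M"
      by (rule expand_in_S_space[OF basis_for_dofs_in_space[OF B(3)]])
    ultimately have "expand (Psi2 M) (E21 M *v (E10 M *v c)) = (\<lambda>p. 0)"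
      by (intro S_space_eq_0[OF M])
    then show ?thesis
      using B(3) unfolding basis_for_dofs_def by blast
  qed
  then have "(E21 M ** E10 M) *v c = 0 *v c" for c
    by (simp flip: matrix_vector_mul_assoc)
  then show ?thesis by (simp add: matrix_eq)
qed

section \<open>Flux of a curl through a small edge\<close>

text \<open>The clockwise quarter turn: it maps the gradient to the curl, and a tangent vector to a
  normal vector of the same length.\<close>

definition rot :: "pt \<Rightarrow> pt" where
  "rot w = vector [w $ 2, - w $ 1]"

lemma inner_2: "(x :: pt) \<bullet> y = x $ 1 * y $ 1 + x $ 2 * y $ 2"
  by (simp add: inner_vec_def UNIV_2)

text \<open>In the plane a unit vector orthogonal to \<open>w\<close> is
  \<open>rot w / norm w\<close> up to sign, and \<open>\<nu> \<bullet> rot w / norm w\<close> is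
  that sign. The first identity thereby removes the square root in the arc-length element from a
  flux integrand.\<close>

lemma unit_normal_eq_rot:
  fixes \<nu> w x :: pt
  assumes "norm \<nu> = 1" "\<nu> \<bullet> w = 0" "w \<noteq> 0"
  shows "(x \<bullet> \<nu>) * norm w = (\<nu> \<bullet> rot w / norm w) * (x \<bullet> rot w)" "(\<nu> \<bullet> rot w / norm w)\<^sup>2 = 1"
proof -
  have n: "\<nu> $ 1 * \<nu> $ 1 + \<nu> $ 2 * \<nu> $ 2 = 1"
    using assms(1) by (simp add: norm_eq_1 inner_2)
  have o: "\<nu> $ 1 * w $ 1 + \<nu> $ 2 * w $ 2 = 0"
    using assms(2) by (simp add: inner_2)
  have w: "norm w * norm w = w $ 1 * w $ 1 + w $ 2 * w $ 2"
    by (simp add: inner_2 flip: dot_square_norm power2_eq_square)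
  have "(x \<bullet> \<nu>) * (norm w * norm w) = (\<nu> \<bullet> rot w) * (x \<bullet> rot w)"
    unfolding w inner_2 rot_def vector_2 using o by algebra
  then show "(x \<bullet> \<nu>) * norm w = (\<nu> \<bullet> rot w / norm w) * (x \<bullet> rot w)"
    using assms(3) by (simp add: field_simps)
  have "(\<nu> \<bullet> rot w)\<^sup>2 = norm w * norm w"
    unfolding w inner_2 rot_def vector_2 using o n by algebra
  then show "(\<nu> \<bullet> rot w / norm w)\<^sup>2 = 1"
    using assms(3) by (simp add: power_divide power2_eq_square)
qed

text \<open>The rotated curl is the gradient, so the flux density of \<open>curl \<omega>\<close> through a curve is a
  tangential derivative of \<open>\<omega>\<close>.  The identity extends to the element boundary by continuity.\<close>

lemma curl_flux_density:
  assumes M: "meshed_domain M" and \<omega>: "\<omega> \<in> C_space M" and q: "q \<in> D_space M"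
    and curl: "\<And>x. x \<in> interior (element M m) \<Longrightarrow> q (m, x) = curl \<omega> x"
    and f: "\<forall>z\<in>ref_square. \<omega> (chart M m z) = f z"
    and f': "\<And>z. (f has_derivative f' z) (at z)" "\<And>v z. (\<lambda>z. f' z v) differentiable (at z)"
    and z: "z \<in> ref_square"
  shows "q (m, chart M m z) \<bullet> rot (jac M m z *v v) = f' z v"
proof -
  obtain D where D: "\<And>x. x \<in> chart M m ` open_square \<Longrightarrow> (\<omega> has_derivative D x) (at x)"
    by (rule C_space_smooth[OF M \<omega>, of m]) (rule that)
  have "q (m, chart M m z) \<bullet> rot (jac M m z *v v) = f' z v" if z: "z \<in> open_square" for z
  proof -
    let ?x = "chart M m z" and ?w = "jac M m z *v v"
    have x: "?x \<in> chart M m ` open_square" and zr: "z \<in> ref_square"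
      using z open_square(3) by auto
    have "q (m, ?x) = curl \<omega> ?x"
      using x chart_open_square(2)[OF M] by (intro curl) auto
    then have "q (m, ?x) \<bullet> rot ?w = D ?x ?w"
      using linear_apply_axes[OF has_derivative_linear[OF D[OF x]], of ?w]
        frechet_derivative_at[OF D[OF x]]
      by (simp add: curl_def rot_def inner_2 UNIV_2 algebra_simps)
    \<comment> \<open>The chain rule gives a derivative of the pullback, which coincides with
      \<open>f\<close> near \<open>z\<close>; uniqueness of derivatives then identifies
      \<open>f' z\<close>.\<close>
    moreover have "((\<lambda>z. \<omega> (chart M m z)) has_derivative (\<lambda>v. D ?x (jac M m z *v v))) (at z)"
      by (rule has_derivative_compose[OF chart_has_derivative[OF M zr] D[OF x]])
    then have "(f has_derivative (\<lambda>v. D ?x (jac M m z *v v))) (at z)"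
      by (rule has_derivative_transform_within_open[OF _ open_square(1) z])
        (use f open_square(3) in auto)
    then have "f' z = (\<lambda>v. D ?x (jac M m z *v v))"
      using f'(1) has_derivative_unique by blast
    ultimately show ?thesis by simp
  qed
  note interior = this
  have "continuous_on ref_square (\<lambda>z. f' z v)"
    using f'(2) differentiable_imp_continuous_within by (intro continuous_at_imp_continuous_on) blast
  moreover have "continuous_on ref_square (\<lambda>z. jac M m z *v v)"
    by (intro continuous_on_matrix_vector_mult jac_continuous M continuous_on_const)
  then have "continuous_on ref_square (\<lambda>z. rot (jac M m z *v v))"
    unfolding rot_def vector_2_eq_axes by (intro continuous_intros continuous_on_component)
  ultimately have cont: "continuous_on (closure open_square) (\<lambda>z. q (m, chart M m z) \<bullet> rot (jac M m z *v v) - f' z v)"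
    unfolding open_square(2) by (intro continuous_on_diff continuous_on_inner D_space_pullback_continuous M q)
  have "q (m, chart M m z) \<bullet> rot (jac M m z *v v) - f' z v = 0"
  proof (rule continuous_constant_on_closure[OF cont])
    show "q (m, chart M m y) \<bullet> rot (jac M m y *v v) - f' y v = 0" if "y \<in> open_square" for y
      using interior[OF that] by simp
    show "z \<in> closure open_square" using z by (simp only: open_square(2))
  qed
  then show ?thesis by simp
qed

text \<open>A continuous function with finite range on a connected set is constant. It excludes that
  a chosen edge normal switches sides along the edge.\<close>

lemma sign_constant:
  fixes \<sigma> :: "real \<Rightarrow> real"
  assumes "continuous_on {0..1} \<sigma>" "\<And>t. t \<in> {0..1} \<Longrightarrow> (\<sigma> t)\<^sup>2 = 1" "t \<in> {0..1}"
  shows "\<sigma> t = \<sigma> 0"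
proof -
  have "\<sigma> ` {0..1} \<subseteq> {-1, 1}"
    using assms(2) by (force simp: power2_eq_1_iff)
  then have "finite (\<sigma> ` {0..1})"
    using finite_subset by blast
  then have "\<sigma> constant_on {0..1}"
    using continuous_finite_range_constant[OF _ assms(1)] by (simp add: connected_Icc)
  then show ?thesis
    using assms(3) unfolding constant_on_def by force
qed

text \<open>By the fundamental theorem of calculus the flux is a sign times the difference of
  \<open>\<omega>\<close> at the end points of the edge, which are mesh nodes. The curl identity is
  assumed for every \<open>m\<close> because the element from which the flux is measured is picked
  by SOME.\<close>

lemma curl_flux_eq_0:
  assumes M: "meshed_domain M" and \<omega>: "\<omega> \<in> C_space M" and q: "q \<in> D_space M"
    and curl: "\<And>m x. x \<in> interior (element M m) \<Longrightarrow> q (m, x) = curl \<omega> x"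
    and 0: "\<And>x. x \<in> edge M e \<inter> mesh_nodes M \<Longrightarrow> \<omega> x = 0"
  shows "dof1 M q $ e = 0"
proof -
  obtain m a b where ab: "(a, b) \<in> ref_edges M" and im: "path_image (chart M m \<circ> linepath a b) = edge M e"
    and ei: "\<And>g. edge_integral M (edge M e) g = integral {0..1}
      (\<lambda>t. g (m, (chart M m \<circ> linepath a b) t) * norm (vector_derivative (chart M m \<circ> linepath a b) (at t)))"
    by (rule edge_integral_chosen_path[OF edge_in_mesh_edges[OF M, of e]]) (rule that)
  note abr = ref_edges_D[OF M ab]
  define \<gamma> where "\<gamma> = chart M m \<circ> linepath a b"
  define w where "w t = jac M m (linepath a b t) *v (b - a)" for t
  define \<nu> where "\<nu> = edge_normal M e"
  note lin = linepath_in_ref_square[OF abr(1,2)]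
  have \<gamma>': "(\<gamma> has_vector_derivative w t) (at t)" if "t \<in> {0..1}" for t
    unfolding \<gamma>_def w_def by (rule edge_path_has_vector_derivative[OF M abr(1,2) that])
  have vd: "vector_derivative \<gamma> (at t) = w t" if "t \<in> {0..1}" for t
    by (rule vector_derivative_at[OF \<gamma>'[OF that]])
  have w0: "w t \<noteq> 0" if "t \<in> {0..1}" for t
    unfolding w_def using jac_mult_nonzero[OF M lin[OF that]] abr(3) by simp
  have wc: "continuous_on {0..1} w"
    unfolding w_def by (rule edge_tangent_continuous[OF M abr(1,2)])
  have \<gamma>c: "continuous_on {0..1} \<gamma>"
    by (intro continuous_at_imp_continuous_on ballI has_vector_derivative_continuous[OF \<gamma>'])
  have \<gamma>E: "\<gamma> t \<in> edge M e" if "t \<in> {0..1}" for t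
    using that unfolding im[symmetric] path_image_def \<gamma>_def by (rule imageI)
  have un: "unit_normal_along M (edge M e) \<nu>"
    using M by (simp add: meshed_domain_def \<nu>_def)
  have "(m, \<gamma>) \<in> edge_paths M (edge M e)"
    using ab im unfolding edge_paths_def \<gamma>_def by blast
  then have \<nu>: "norm (\<nu> (\<gamma> t)) = 1" "\<nu> (\<gamma> t) \<bullet> w t = 0" if "t \<in> {0..1}" for t
    using un \<gamma>E[OF that] vd[OF that] that unfolding unit_normal_along_def by fastforce+
  \<comment> \<open>The sign of the chosen normal relative to the rotated tangent.\<close>
  define \<sigma> where "\<sigma> t = \<nu> (\<gamma> t) \<bullet> rot (w t) / norm (w t)" for t
  have "continuous_on {0..1} (\<lambda>t. \<nu> (\<gamma> t))"
    by (rule continuous_on_compose2[OF _ \<gamma>c]) (use un \<gamma>E in \<open>auto simp: unit_normal_along_def\<close>)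
  then have "continuous_on {0..1} \<sigma>"
    unfolding \<sigma>_def rot_def vector_2_eq_axes
    by (intro continuous_intros continuous_on_component wc) (use w0 in auto)
  moreover have "(\<sigma> t)\<^sup>2 = 1" if "t \<in> {0..1}" for t
    unfolding \<sigma>_def using unit_normal_eq_rot(2)[OF \<nu>[OF that] w0[OF that]] .
  ultimately have \<sigma>: "\<sigma> t = \<sigma> 0" if "t \<in> {0..1}" for t
    using sign_constant that by blast
  obtain f where f: "f \<in> C_ref (degr M)" "\<forall>z\<in>ref_square. \<omega> (chart M m z) = f z"
    by (rule C_space_pullback[where m = m, OF \<omega>])
  obtain f' where f': "\<And>z. (f has_derivative f' z) (at z)" "\<And>v z. (\<lambda>z. f' z v) differentiable (at z)"
    by (rule tensor_poly_smooth[OF f(1)[unfolded C_ref_def]]) (rule that)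
  \<comment> \<open>\<open>\<omega>\<close> may fail to be differentiable on an interface, but its
    polynomial pullback \<open>f\<close> is smooth on the whole plane.\<close>
  have "((\<lambda>t. f (linepath a b t)) has_vector_derivative f' (linepath a b t) (b - a)) (at t within {0..1})" for t
  proof -
    have "(linepath a b has_derivative (\<lambda>h. h *\<^sub>R (b - a))) (at t within {0..1})"
      using has_vector_derivative_linepath_within[of a b t "{0..1}"] by (simp add: has_vector_derivative_def)
    from has_derivative_compose[OF this f'(1)] show ?thesis
      by (simp add: has_vector_derivative_def linear_scale[OF has_derivative_linear[OF f'(1)]])
  qed
  then have "((\<lambda>t. f' (linepath a b t) (b - a)) has_integral
      f (linepath a b 1) - f (linepath a b 0)) {0..1}"
    by (intro fundamental_theorem_of_calculus) auto
  moreover have "f a = 0" "f b = 0"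
  proof -
    have "\<gamma> 0 = chart M m a" "\<gamma> 1 = chart M m b"
      by (simp_all add: \<gamma>_def linepath_def)
    then have "\<omega> (chart M m a) = 0" "\<omega> (chart M m b) = 0"
      using \<gamma>E[of 0] \<gamma>E[of 1] abr(4,5)[of m] by (auto intro!: 0)
    then show "f a = 0" "f b = 0"
      using f(2) abr(1,2) by auto
  qed
  ultimately have "((\<lambda>t. f' (linepath a b t) (b - a)) has_integral 0) {0..1}"
    by (simp add: linepath_def)
  then have "((\<lambda>t. \<sigma> 0 * f' (linepath a b t) (b - a)) has_integral 0) {0..1}"
    using has_integral_mult_right[of _ 0 _ "\<sigma> 0"] by simp
  \<comment> \<open>Constancy of the sign makes the flux density a fixed multiple of the derivative
    of \<open>f\<close> along the segment.\<close>
  moreover have "\<sigma> 0 * f' (linepath a b t) (b - a) =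
      (q (m, \<gamma> t) \<bullet> \<nu> (\<gamma> t)) * norm (vector_derivative \<gamma> (at t))" if t: "t \<in> {0..1}" for t
  proof -
    have "q (m, \<gamma> t) \<bullet> rot (w t) = f' (linepath a b t) (b - a)"
      unfolding \<gamma>_def w_def o_apply
      by (rule curl_flux_density[OF M \<omega> q curl f(2) f' lin[OF t]])
    then show ?thesis
      using unit_normal_eq_rot(1)[OF \<nu>[OF t] w0[OF t], of "q (m, \<gamma> t)"]
      unfolding \<sigma>_def[symmetric] \<sigma>[OF t] vd[OF t] by simp
  qed
  ultimately have "((\<lambda>t. (q (m, \<gamma> t) \<bullet> \<nu> (\<gamma> t)) * norm (vector_derivative \<gamma> (at t))) has_integral 0) {0..1}"
    by (rule has_integral_eq[rotated])
  then have "integral {0..1} (\<lambda>t. (q (m, \<gamma> t) \<bullet> \<nu> (\<gamma> t)) * norm (vector_derivative \<gamma> (at t))) = 0"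
    by (rule integral_unique)
  then show ?thesis
    unfolding dof1_def vec_lambda_beta ei prod.case \<gamma>_def \<nu>_def .
qed

text \<open>The entry is the flux through the edge of the curl of the nodal basis function of
  \<open>i\<close>, and this function vanishes at all other nodes, in particular at the end points
  of a boundary edge.\<close>

lemma E10_boundary_edge_interior_node:
  assumes dM: "discretization M" and e: "edge M e \<subseteq> frontier (region M)" and i: "node M i \<notin> frontier (region M)"
  shows "E10 M $ e $ i = 0"
proof -
  note M = discretization_D(1)[OF dM] and B = discretization_D(2,3)[OF dM]
  define \<omega> where "\<omega> = Psi0 M i"
  have \<omega>: "\<omega> \<in> C_space M"
    unfolding \<omega>_def by (rule basis_for_dofs_in_space[OF B(1)])
  have dof: "dof0 M \<omega> = axis i 1"
    using dof_expand[OF B(1), of "axis i 1"] \<omega> by (simp add: expand_axis \<omega>_def)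
  define q where "q = expand (Psi1 M) (E10 M *v dof0 M \<omega>)"
  have q: "q \<in> D_space M"
    unfolding q_def by (rule expand_in_D_space[OF basis_for_dofs_in_space[OF B(2)]])
  have dq: "dof1 M q = E10 M *v dof0 M \<omega>"
    using dof_expand[OF B(2)] q unfolding q_def by blast
  have "\<omega> x = 0" if x: "x \<in> edge M e \<inter> mesh_nodes M" for x
  proof -
    have "range (node M) = mesh_nodes M"
      using M by (simp add: meshed_domain_def bij_betw_def)
    then obtain j where j: "x = node M j" using x by blast
    \<comment> \<open>Nodes on the edge lie on the frontier, whereas node \<open>i\<close> does
      not.\<close>
    then have "j \<noteq> i" using i e x by blast
    have "\<omega> (node M j) = dof0 M \<omega> $ j" by (simp add: dof0_def)
    then show ?thesis using dof \<open>j \<noteq> i\<close> j by (simp add: axis_def)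
  qed
  moreover have "q (m, x) = curl \<omega> x" if "x \<in> interior (element M m)" for m x
    using discretization_D(5)[OF dM \<omega> that] by (simp add: q_def)
  ultimately have "dof1 M q $ e = 0"
    by (intro curl_flux_eq_0[OF M \<omega> q]) auto
  then show ?thesis
    unfolding dq dof by (simp add: matrix_vector_mult_basis column_def)
qed

section \<open>Restriction to the boundary nodes and extension by zero\<close>

lemma matrix_vector_mult_uminus: "A *v (- x) = - (A *v x)" for A :: "real^'n^'m"
  using matrix_vector_mult_diff_distrib[of A 0 x] by simp

lemma incl0_transpose_mult:
  assumes M: "meshed_domain M" and x: "\<And>i. node M i \<notin> frontier (region M) \<Longrightarrow> x $ i = 0"
  shows "incl0 M *v (transpose (incl0 M) *v x) = x"
proof -
  have "(incl0 M *v (transpose (incl0 M) *v x)) $ i = x $ i" for i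
  proof (cases "node M i \<in> frontier (region M)")
    case True
    moreover have "range (bnode M) = {i. node M i \<in> frontier (region M)}"
      using M by (simp add: meshed_domain_def bij_betw_def)
    ultimately obtain b where "i = bnode M b" by blast
    moreover have "(transpose (incl0 M) *v x) $ b = x $ bnode M b"
      by (simp add: incl0_def transpose_def matrix_vector_mult_def if_distrib[of "\<lambda>x. x * _"] cong: if_cong)
    ultimately show ?thesis by (simp add: incl0_mult_bnode[OF M])
  next
    case False
    then have "i \<noteq> bnode M b" for b
      using bnode_frontier[OF M, of b] by auto
    then show ?thesis
      using x[OF False] by (simp add: incl0_def matrix_vector_mult_def)
  qed
  then show ?thesis by (simp add: vec_eq_iff)
qed

lemma E10_transpose_incl1:
  assumes dM: "discretization M" and i: "node M i \<notin> frontier (region M)"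
  shows "(transpose (E10 M) *v (incl1 M *v \<beta>)) $ i = 0"
proof -
  \<comment> \<open>The sum over edges vanishes term by term: at a boundary edge the entry of
    \<open>E10\<close> is zero, at any other edge the row of \<open>incl1\<close> is.\<close>
  have "E10 M $ e $ i * (incl1 M *v \<beta>) $ e = 0" for e
  proof (cases "\<exists>b. e = bedge M b")
    case True
    then show ?thesis
      using E10_boundary_edge_interior_node[OF dM _ i] bedge_frontier[OF discretization_D(1)[OF dM]] by auto
  next
    case False
    then show ?thesis by (simp add: incl1_def matrix_vector_mult_def)
  qed
  then show ?thesis
    unfolding matrix_vector_mult_def[of "transpose (E10 M)"] by (simp add: transpose_def sum.neutral del: mult_eq_0_iff)
qed

section \<open>The dual operators\<close>

text \<open>The dual basis inserts the inverse of \<open>mass1\<close> and the dual degrees of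
  freedom multiply by \<open>mass1\<close>; the two cancel.\<close>

lemma dual_dof1_expand_dual_Psi1:
  assumes dM: "discretization M"
  shows "dual_dof1 M (expand (dual_Psi1 M) v) = v"
proof -
  note M = discretization_D(1)[OF dM] and B = discretization_D(3)[OF dM]
  have "expand (Psi1 M) (matrix_inv (mass1 M) *v v) \<in> D_space M"
    by (rule expand_in_D_space[OF basis_for_dofs_in_space[OF B]])
  from dof_expand[OF B this] show ?thesis
    unfolding dual_dof1_def dual_Psi1_def expand_row_mult
    using matrix_inv_of_injective[OF mass1_injective[OF M B]] by simp
qed

lemma bd_coeff1_expand_dual_Psi_b1:
  assumes dM: "discretization M"
  shows "bd_coeff1 M (expand (dual_Psi_b1 M) c) = c"
  unfolding bd_coeff1_def
  using dual_Psi_b1_independent[OF discretization_D(1,2)[OF dM]] by (intro the_equality) auto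

lemma ROT_GRAD:
  assumes dM: "discretization M"
  shows "ROT M (GRAD M (s, s')) = ((\<lambda>x. 0), (\<lambda>x. 0))"
proof -
  define n where "n = dual_dof0 M s"
  define \<beta> where "\<beta> = bd_coeff0 M s'"
  let ?E = "transpose (E10 M)" and ?N = "incl0 M"
  let ?x = "?E *v (incl1 M *v \<beta>)"
  have "?E *v (transpose (E21 M) *v n) = transpose (E21 M ** E10 M) *v n"
    by (simp only: matrix_transpose_mul matrix_vector_mul_assoc)
  also have "\<dots> = 0"
    by (simp add: E21_E10_eq_0[OF dM] transpose_def matrix_vector_mult_def vec_eq_iff)
  finally have 1: "?E *v (- (transpose (E21 M) *v n)) = 0"
    by (simp add: matrix_vector_mult_uminus)
  \<comment> \<open>\<open>?x\<close> is supported on the boundary nodes, so restricting it to them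
    and extending by zero returns it unchanged.\<close>
  have 2: "?N *v (- ((transpose ?N ** ?E ** incl1 M) *v \<beta>)) = - ?x"
    using incl0_transpose_mult[OF discretization_D(1)[OF dM] E10_transpose_incl1[OF dM]]
    by (simp add: matrix_vector_mult_uminus flip: matrix_vector_mul_assoc)
  have "?E *v (- (transpose (E21 M) *v n) + incl1 M *v \<beta>) +
      ?N *v (- ((transpose ?N ** ?E ** incl1 M) *v \<beta>)) = 0"
    unfolding 2 matrix_vector_right_distrib 1 by simp
  then show ?thesis
    by (simp add: ROT_def GRAD_def dual_dof1_expand_dual_Psi1[OF dM] bd_coeff1_expand_dual_Psi_b1[OF dM]
        expand_zero flip: n_def \<beta>_def)
qed

text \<open>A dual expansion is a primal one with coefficients changed by an inverse mass matrix,
  and a nodal boundary expansion is the trace of a function in \<open>C_space M\<close>.\<close>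

lemma GRAD_in_dual_spaces:
  assumes dM: "discretization M"
  shows "GRAD M (s, s') \<in> dual_D_space M \<times> dual_C_bd_space M"
proof -
  note B = discretization_D(2,3)[OF dM]
  have "expand (dual_Psi1 M) v \<in> D_space M" for v
    unfolding dual_Psi1_def expand_row_mult
    by (rule expand_in_D_space[OF basis_for_dofs_in_space[OF B(2)]])
  moreover have "expand (dual_Psi_b1 M) c \<in> C_bd_space M" for c
    unfolding dual_Psi_b1_def expand_row_mult expand_Psi_b0 C_bd_space_def
    by (intro imageI expand_in_C_space[OF basis_for_dofs_in_space[OF B(1)]])
  ultimately show ?thesis
    by (simp add: GRAD_def dual_D_space_def dual_C_bd_space_def)
qed

theorem mainTheorem2:
  fixes M :: "('m::finite, 'n::finite, 'e::finite, 'c::finite, 'bn::finite, 'be::finite) fem_mesh"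
  assumes "discretization M"
  shows "(\<forall>s\<in>dual_S_space M. \<forall>s'\<in>dual_D_bd_space M.
            ROT M (GRAD M (s, s')) = ((\<lambda>x. 0), (\<lambda>x. 0))) \<and>
         GRAD M ` (dual_S_space M \<times> dual_D_bd_space M) \<subseteq>
           {p \<in> dual_D_space M \<times> dual_C_bd_space M. ROT M p = ((\<lambda>x. 0), (\<lambda>x. 0))}"
  using ROT_GRAD[OF assms] GRAD_in_dual_spaces[OF assms] by blast

end
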